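(* Let $u_\delta$ minimize $I_{\mu,\delta}$ on $\mathcal M_m^+$. Suppose signed constrained variations are admissible at $u_\delta$. Then there is a unique Lagrange multiplier $\lambda_\delta\in\mathbb R$ such that the Euler–Lagrange identity $$\int_\Omega A_\varepsilon(x,\nabla u_\delta)\cdot\nabla\phi\,dx=\lambda_\delta\int_\Omega u_\delta^{p(x)-1}\phi\,dx+\mu\int_\Omega h(x)(u_\delta+\delta)^{-\gamma(x)}\phi\,dx$$ holds for every $\phi\in X$.
   Context: Standing assumptions: $N\ge2$ and $\Omega\subset\mathbb R^N$ is a bounded domain with Lipschitz boundary; $\varepsilon>0$, $m>0$, $\mu\ge0$ and $0<\delta\le1$ are fixed. The exponent $p:\overline\Omega\to(1,\infty)$ satisfies $1<p^-\le p(x)\le p^+<\infty$, where $p^-=\min_{\overline\Omega}p$ and $p^+=\max_{\overline\Omega}p$, and is log-Hölder continuous: there is $C_{\log}>0$ with $|p(x)-p(y)|\le C_{\log}/\log(e+1/|x-y|)$ for all $x\ne y$ in $\overline\Omega$. Further $h\in L^\infty(\Omega)$, $h\ge0$ a.e. in $\Omega$, $h\not\equiv0$; and $\gamma\in C(\overline\Omega)$ with $0<\gamma^-\le\gamma(x)\le\gamma^+<1$ for every $x\in\overline\Omega$, where $\gamma^\pm$ are constants. Spaces: $L^{p(\cdot)}(\Omega)$ is the space of measurable $u:\Omega\to\mathbb R$ with $\int_\Omega|u|^{p(x)}dx<\infty$, with the Luxemburg norm $\|u\|_{p(\cdot)}=\inf\{\tau>0:\int_\Omega|u/\tau|^{p(x)}dx\le1\}$.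 $W^{1,p(\cdot)}(\Omega)=\{u\in L^{p(\cdot)}(\Omega):|\nabla u|\in L^{p(\cdot)}(\Omega)\}$ with norm $\|u\|_{p(\cdot)}+\|\nabla u\|_{p(\cdot)}$; $X=W^{1,p(\cdot)}_0(\Omega)$ is the closure of $C_0^\infty(\Omega)$ in $W^{1,p(\cdot)}(\Omega)$, with the equivalent norm $\|u\|=\|\nabla u\|_{p(\cdot)}$. $X_+=\{u\in X:u\ge0\text{ a.e. in }\Omega\}$. Functionals: for $\xi\in\mathbb R^N$, $r_\varepsilon(\xi)=(\varepsilon^2+|\xi|^2)^{1/2}$, $A_\varepsilon(x,\xi)=r_\varepsilon(\xi)^{p(x)-2}\xi$, $\Phi_\varepsilon(x,\xi)=\frac{r_\varepsilon(\xi)^{p(x)}-\varepsilon^{p(x)}}{p(x)}$; $E_\varepsilon(u)=\int_\Omega\Phi_\varepsilon(x,\nabla u)\,dx$ and $J(u)=\int_\Omega\frac{|u|^{p(x)}}{p(x)}dx$ for $u\in X$; $\mathcal M_m=\{u\in X:J(u)=m\}$ and $\mathcal M_m^+=\mathcal M_m\cap X_+$. For $s\ge0$, $G_\delta(x,s)=\frac{(s+\delta)^{1-\gamma(x)}-\delta^{1-\gamma(x)}}{1-\gamma(x)}$, and $I_{\mu,\delta}(u)=E_\varepsilon(u)-\mu\int_\Omega h(x)G_\delta(x,u)\,dx$ for $u\in X_+$. On the hypothesis "signed constrained variations are admissible at $u_\delta$": the source gives no separate formal definition of this phrase. It explains it in these words: "More precisely, the positivity and truncation-renormalization argument ensures that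 $u_\delta$ is a critical point of $I_{\mu,\delta}$ with respect to all variations tangent to the equality constraint $J(u)=m$." Here the tangent space at $u_\delta$ is $\ker J'(u_\delta)=\{\phi\in X:\int_\Omega u_\delta^{p(x)-1}\phi\,dx=0\}$. *)

theory Defs
  imports "HOL-Analysis.Analysis"
begin

section \<open>Domains with Lipschitz boundary\<close>

text \<open>Near each boundary point the domain is, in suitable orthogonal coordinates with last axis
  \<open>\<nu>\<close>, the strict epigraph of a Lipschitz function on the hyperplane orthogonal to \<open>\<nu>\<close>.\<close>

definition lipschitz_boundary :: "'a::euclidean_space set \<Rightarrow> bool" where
  "lipschitz_boundary \<Omega> \<longleftrightarrow>
     (\<forall>x\<^sub>0\<in>frontier \<Omega>. \<exists>\<nu> r L g. norm \<nu> = 1 \<and> 0 < r \<and> L-lipschitz_on {z. z \<bullet> \<nu> = 0} g \<and>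
        \<Omega> \<inter> ball x\<^sub>0 r = {y \<in> ball x\<^sub>0 r. g (y - (y \<bullet> \<nu>) *\<^sub>R \<nu>) < y \<bullet> \<nu>})"

definition bounded_lipschitz_domain :: "'a::euclidean_space set \<Rightarrow> bool" where
  "bounded_lipschitz_domain \<Omega> \<longleftrightarrow>
     open \<Omega> \<and> connected \<Omega> \<and> \<Omega> \<noteq> {} \<and> bounded \<Omega> \<and> lipschitz_boundary \<Omega>"


section \<open>Variable exponents and data\<close>

definition log_holder_on :: "'a::euclidean_space set \<Rightarrow> ('a \<Rightarrow> real) \<Rightarrow> bool" where
  "log_holder_on S p \<longleftrightarrow>
     (\<exists>C>0. \<forall>x\<in>S. \<forall>y\<in>S. x \<noteq> y \<longrightarrow> \<bar>p x - p y\<bar> \<le> C / ln (exp 1 + 1 / norm (x - y)))"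

text \<open>For bounded \<open>\<Omega>\<close> a log-Hoelder exponent is continuous on the compact closure, so the extrema
  below are attained and are the numbers \<open>p\<^sup>-\<close> and \<open>p\<^sup>+\<close>.\<close>

definition variable_exponent :: "'a::euclidean_space set \<Rightarrow> ('a \<Rightarrow> real) \<Rightarrow> bool" where
  "variable_exponent \<Omega> p \<longleftrightarrow>
     (\<exists>p_min p_max. 1 < p_min \<and>
        (\<exists>x\<in>closure \<Omega>. p x = p_min) \<and> (\<exists>x\<in>closure \<Omega>. p x = p_max) \<and>
        (\<forall>x\<in>closure \<Omega>. p_min \<le> p x \<and> p x \<le> p_max)) \<and>
     log_holder_on (closure \<Omega>) p"

definition Linfty :: "'a::euclidean_space set \<Rightarrow> ('a \<Rightarrow> real) set" where
  "Linfty \<Omega> = {f \<in> borel_measurable (lebesgue_on \<Omega>). \<exists>C. AE x in lebesgue_on \<Omega>. \<bar>f x\<bar> \<le> C}"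


section \<open>Test functions and weak gradients\<close>

primrec Ck :: "nat \<Rightarrow> ('a::euclidean_space \<Rightarrow> real) \<Rightarrow> bool" where
  "Ck 0 f \<longleftrightarrow> continuous_on UNIV f"
| "Ck (Suc k) f \<longleftrightarrow>
     f differentiable_on UNIV \<and> (\<forall>i\<in>Basis. Ck k (\<lambda>x. frechet_derivative f (at x) i))"

text \<open>Test functions on \<open>\<Omega>\<close> are represented by their extension by zero to the whole space.\<close>

definition test_functions :: "'a::euclidean_space set \<Rightarrow> ('a \<Rightarrow> real) set" where
  "test_functions \<Omega> =
     {\<psi>. (\<forall>k. Ck k \<psi>) \<and> compact (closure {x. \<psi> x \<noteq> 0}) \<and> closure {x. \<psi> x \<noteq> 0} \<subseteq> \<Omega>}"

definition has_weak_gradient ::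
    "'a::euclidean_space set \<Rightarrow> ('a \<Rightarrow> real) \<Rightarrow> ('a \<Rightarrow> 'a) \<Rightarrow> bool" where
  "has_weak_gradient \<Omega> u g \<longleftrightarrow>
     (\<forall>K. compact K \<and> K \<subseteq> \<Omega> \<longrightarrow> set_integrable lebesgue K u \<and> set_integrable lebesgue K g) \<and>
     (\<forall>\<psi>\<in>test_functions \<Omega>. \<forall>i\<in>Basis.
        (\<integral>x. u x * frechet_derivative \<psi> (at x) i \<partial>lebesgue_on \<Omega>)
          = - (\<integral>x. (g x \<bullet> i) * \<psi> x \<partial>lebesgue_on \<Omega>))"

text \<open>A representative of the weak gradient, which is determined up to null sets of \<open>\<Omega>\<close>.\<close>

definition weak_grad :: "'a::euclidean_space set \<Rightarrow> ('a \<Rightarrow> real) \<Rightarrow> 'a \<Rightarrow> 'a" where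
  "weak_grad \<Omega> u = (SOME g. has_weak_gradient \<Omega> u g)"


section \<open>Variable exponent Lebesgue and Sobolev spaces\<close>

text \<open>Elements of the spaces are represented by functions on the whole space of which only the
  values on \<open>\<Omega>\<close>, up to null sets, matter.\<close>

definition modular ::
    "'a::euclidean_space set \<Rightarrow> ('a \<Rightarrow> real) \<Rightarrow> ('a \<Rightarrow> real) \<Rightarrow> ennreal" where
  "modular \<Omega> p u = (\<integral>\<^sup>+ x. ennreal (\<bar>u x\<bar> powr p x) \<partial>lebesgue_on \<Omega>)"

definition Lp :: "'a::euclidean_space set \<Rightarrow> ('a \<Rightarrow> real) \<Rightarrow> ('a \<Rightarrow> real) set" where
  "Lp \<Omega> p = {u \<in> borel_measurable (lebesgue_on \<Omega>). modular \<Omega> p u < \<infinity>}"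

definition luxemburg_norm ::
    "'a::euclidean_space set \<Rightarrow> ('a \<Rightarrow> real) \<Rightarrow> ('a \<Rightarrow> real) \<Rightarrow> real" where
  "luxemburg_norm \<Omega> p u = Inf {\<tau>. 0 < \<tau> \<and> modular \<Omega> p (\<lambda>x. u x / \<tau>) \<le> 1}"

definition W1p :: "'a::euclidean_space set \<Rightarrow> ('a \<Rightarrow> real) \<Rightarrow> ('a \<Rightarrow> real) set" where
  "W1p \<Omega> p = {u \<in> Lp \<Omega> p.
     (\<exists>g. has_weak_gradient \<Omega> u g) \<and> (\<lambda>x. norm (weak_grad \<Omega> u x)) \<in> Lp \<Omega> p}"

definition W1p_norm ::
    "'a::euclidean_space set \<Rightarrow> ('a \<Rightarrow> real) \<Rightarrow> ('a \<Rightarrow> real) \<Rightarrow> real" where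
  "W1p_norm \<Omega> p u =
     luxemburg_norm \<Omega> p u + luxemburg_norm \<Omega> p (\<lambda>x. norm (weak_grad \<Omega> u x))"

definition W01p :: "'a::euclidean_space set \<Rightarrow> ('a \<Rightarrow> real) \<Rightarrow> ('a \<Rightarrow> real) set" where
  "W01p \<Omega> p = {u \<in> W1p \<Omega> p.
     \<forall>e>0. \<exists>\<psi>\<in>test_functions \<Omega>. W1p_norm \<Omega> p (\<lambda>x. u x - \<psi> x) < e}"

definition W01p_nonneg :: "'a::euclidean_space set \<Rightarrow> ('a \<Rightarrow> real) \<Rightarrow> ('a \<Rightarrow> real) set" where
  "W01p_nonneg \<Omega> p = {u \<in> W01p \<Omega> p. AE x in lebesgue_on \<Omega>. 0 \<le> u x}"


section \<open>Functionals and constraint sets\<close>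

definition r_eps :: "real \<Rightarrow> 'a::euclidean_space \<Rightarrow> real" where
  "r_eps \<epsilon> \<xi> = sqrt (\<epsilon>\<^sup>2 + (norm \<xi>)\<^sup>2)"

definition A_eps :: "real \<Rightarrow> ('a \<Rightarrow> real) \<Rightarrow> 'a \<Rightarrow> 'a \<Rightarrow> 'a::euclidean_space" where
  "A_eps \<epsilon> p x \<xi> = (r_eps \<epsilon> \<xi> powr (p x - 2)) *\<^sub>R \<xi>"

definition Phi_eps :: "real \<Rightarrow> ('a \<Rightarrow> real) \<Rightarrow> 'a \<Rightarrow> 'a::euclidean_space \<Rightarrow> real" where
  "Phi_eps \<epsilon> p x \<xi> = (r_eps \<epsilon> \<xi> powr p x - \<epsilon> powr p x) / p x"

definition E_eps ::
    "'a::euclidean_space set \<Rightarrow> ('a \<Rightarrow> real) \<Rightarrow> real \<Rightarrow> ('a \<Rightarrow> real) \<Rightarrow> real" where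
  "E_eps \<Omega> p \<epsilon> u = (\<integral>x. Phi_eps \<epsilon> p x (weak_grad \<Omega> u x) \<partial>lebesgue_on \<Omega>)"

definition J_fun :: "'a::euclidean_space set \<Rightarrow> ('a \<Rightarrow> real) \<Rightarrow> ('a \<Rightarrow> real) \<Rightarrow> real" where
  "J_fun \<Omega> p u = (\<integral>x. \<bar>u x\<bar> powr p x / p x \<partial>lebesgue_on \<Omega>)"

definition M_plus ::
    "'a::euclidean_space set \<Rightarrow> ('a \<Rightarrow> real) \<Rightarrow> real \<Rightarrow> ('a \<Rightarrow> real) set" where
  "M_plus \<Omega> p m = {u \<in> W01p_nonneg \<Omega> p. J_fun \<Omega> p u = m}"

text \<open>For \<open>s < 0\<close>, where the formula is not available, \<open>G_delta\<close> is continued by its tangent line at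
  \<open>0\<close>. As the slope of \<open>G_delta\<close> at \<open>0\<close> is \<open>\<delta> powr - \<gamma> x\<close>, the continuation is continuously
  differentiable. It is needed only to evaluate the functional at sign-changing variations
  \<open>u + t \<phi>\<close> of a nonnegative \<open>u\<close>, and does not affect the values on nonnegative functions.\<close>

definition G_delta :: "real \<Rightarrow> ('a \<Rightarrow> real) \<Rightarrow> 'a \<Rightarrow> real \<Rightarrow> real" where
  "G_delta \<delta> \<gamma> x s =
     (if 0 \<le> s then ((s + \<delta>) powr (1 - \<gamma> x) - \<delta> powr (1 - \<gamma> x)) / (1 - \<gamma> x)
      else \<delta> powr (- \<gamma> x) * s)"

definition I_fun ::
    "'a::euclidean_space set \<Rightarrow> ('a \<Rightarrow> real) \<Rightarrow> real \<Rightarrow> ('a \<Rightarrow> real) \<Rightarrow> ('a \<Rightarrow> real) \<Rightarrow> real \<Rightarrow> real \<Rightarrow>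
     ('a \<Rightarrow> real) \<Rightarrow> real" where
  "I_fun \<Omega> p \<epsilon> h \<gamma> \<mu> \<delta> u =
     E_eps \<Omega> p \<epsilon> u - \<mu> * (\<integral>x. h x * G_delta \<delta> \<gamma> x (u x) \<partial>lebesgue_on \<Omega>)"

definition minimizes_on :: "('b \<Rightarrow> real) \<Rightarrow> 'b set \<Rightarrow> 'b \<Rightarrow> bool" where
  "minimizes_on F S u \<longleftrightarrow> u \<in> S \<and> (\<forall>v\<in>S. F u \<le> F v)"

text \<open>The kernel of the derivative of \<open>J_fun\<close> at a nonnegative \<open>u\<close>.\<close>

definition tangent_space ::
    "'a::euclidean_space set \<Rightarrow> ('a \<Rightarrow> real) \<Rightarrow> ('a \<Rightarrow> real) \<Rightarrow> ('a \<Rightarrow> real) set" where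
  "tangent_space \<Omega> p u =
     {\<phi> \<in> W01p \<Omega> p. (\<integral>x. u x powr (p x - 1) * \<phi> x \<partial>lebesgue_on \<Omega>) = 0}"

text \<open>Admissibility of signed constrained variations: \<open>u\<close> is a critical point of the functional with
  respect to all variations tangent to the equality constraint, without sign condition.\<close>

definition signed_variations_admissible ::
    "'a::euclidean_space set \<Rightarrow> ('a \<Rightarrow> real) \<Rightarrow> real \<Rightarrow> ('a \<Rightarrow> real) \<Rightarrow> ('a \<Rightarrow> real) \<Rightarrow> real \<Rightarrow> real \<Rightarrow>
     ('a \<Rightarrow> real) \<Rightarrow> bool" where
  "signed_variations_admissible \<Omega> p \<epsilon> h \<gamma> \<mu> \<delta> u \<longleftrightarrow>
     (\<forall>\<phi>\<in>tangent_space \<Omega> p u.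
        ((\<lambda>t. I_fun \<Omega> p \<epsilon> h \<gamma> \<mu> \<delta> (\<lambda>x. u x + t * \<phi> x)) has_real_derivative 0) (at 0))"

end

theory Submission
  imports Defs "HOL-Computational_Algebra.Polynomial"
begin

text \<open>
  Write \<open>L \<phi>\<close> for the difference of the gradient term and the singular term of the Euler--Lagrange
  identity, and \<open>B \<phi>\<close> for the integral of \<open>u\<^sup>p\<^sup>-\<^sup>1 \<phi>\<close>. Both are linear in \<open>\<phi>\<close>. The derivative at \<open>t = 0\<close> of
  the functional along \<open>u + t \<phi>\<close> exists for every direction \<open>\<phi>\<close> in the Sobolev space, whatever its sign,
  and equals \<open>L \<phi>\<close> (\<open>E_eps_has_derivative\<close> and \<open>singular_term_has_derivative\<close>). Admissibility of signed
  constrained variations therefore says precisely that \<open>L\<close> vanishes on the kernel of \<open>B\<close>. On the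
  constraint set \<open>B u\<close> is the integral of \<open>u\<^sup>p\<close>, which is positive because \<open>m > 0\<close>. So \<open>u\<close> itself is
  a direction transversal to the kernel, and \<open>L = \<Lambda> B\<close> for exactly one \<open>\<Lambda>\<close>, namely
  \<open>L u / B u\<close> (\<open>ex1_multiplier\<close>).

  Most of the work goes into the linear structure on which this argument rests. The representative
  \<open>weak_grad\<close> is an arbitrary choice, so its linearity up to null sets requires uniqueness of weak
  gradients, that is, the fundamental lemma of the calculus of variations
  (\<open>AE_zero_if_orthogonal_to_test_functions\<close>). It is proved with explicit smooth bumps that
  converge to indicators of boxes. For the Sobolev space with zero boundary values to be closed under
  linear combinations (\<open>W01p_diff_cmult\<close>), one needs the triangle inequality of the Luxemburg norm
  (\<open>luxemburg_norm_le_combination\<close>) and that test functions are Sobolev functions, which is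
  integration by parts; the latter follows from translation invariance of the integral and
  differentiation under the integral sign. The same differentiation lemma yields the derivatives of
  the functionals, with dominating functions supplied by the mean value theorem.
\<close>

section \<open>Smooth functions and bumps on boxes\<close>

lemma frechet_derivative_eqI:
  "(f has_derivative D) (at x) \<Longrightarrow> frechet_derivative f (at x) = D"
  using frechet_derivative_at by fastforce

lemma Ck_SucD: "Ck (Suc k) f \<Longrightarrow> Ck k f"
proof (induction k arbitrary: f)
  case 0
  then show ?case by (simp add: differentiable_imp_continuous_on)
next
  case (Suc k)
  then show ?case by auto
qed

lemma Ck_const: "Ck k (\<lambda>x. c)"
  by (induction k arbitrary: c) simp_all

lemma Ck_add: "Ck k f \<Longrightarrow> Ck k g \<Longrightarrow> Ck k (\<lambda>x. f x + g x)"
proof (induction k arbitrary: f g)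
  case 0
  then show ?case by (simp add: continuous_on_add)
next
  case (Suc k)
  have d: "(f has_derivative frechet_derivative f (at x)) (at x)"
    "(g has_derivative frechet_derivative g (at x)) (at x)" for x
    using Suc.prems by (auto simp: frechet_derivative_works[symmetric] differentiable_on_def)
  have "frechet_derivative (\<lambda>x. f x + g x) (at x) i
      = frechet_derivative f (at x) i + frechet_derivative g (at x) i" for x i
    by (subst frechet_derivative_eqI[OF has_derivative_add[OF d]]) simp
  then show ?case using Suc by simp
qed

lemma Ck_mult: "Ck k f \<Longrightarrow> Ck k g \<Longrightarrow> Ck k (\<lambda>x. f x * g x)"
proof (induction k arbitrary: f g)
  case 0
  then show ?case by (simp add: continuous_on_mult)
next
  case (Suc k)
  have d: "(f has_derivative frechet_derivative f (at x)) (at x)"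
    "(g has_derivative frechet_derivative g (at x)) (at x)" for x
    using Suc.prems by (auto simp: frechet_derivative_works[symmetric] differentiable_on_def)
  have "frechet_derivative (\<lambda>x. f x * g x) (at x) i
      = f x * frechet_derivative g (at x) i + frechet_derivative f (at x) i * g x" for x i
    by (subst frechet_derivative_eqI[OF has_derivative_mult[OF d]]) simp
  moreover have "Ck k f" "Ck k g" using Suc.prems Ck_SucD by blast+
  ultimately show ?case using Suc by (auto intro!: Ck_add)
qed

lemma Ck_prod: "finite I \<Longrightarrow> (\<And>i. i \<in> I \<Longrightarrow> Ck k (f i)) \<Longrightarrow> Ck k (\<lambda>x. \<Prod>i\<in>I. f i x)"
  by (induction I rule: finite_induct) (auto intro: Ck_const Ck_mult)

text \<open>A smooth function of one variable is given as the whole sequence \<open>F\<close> of its derivatives, so that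
  the induction on the order of differentiability only shifts the index.\<close>

lemma Ck_compose_affine:
  fixes F :: "nat \<Rightarrow> real \<Rightarrow> real" and b :: "'a::euclidean_space"
  assumes F: "\<And>j t. (F j has_real_derivative F (Suc j) t) (at t)"
  shows "Ck k (\<lambda>x. F j (c * (x \<bullet> b) + d))"
proof (induction k arbitrary: j)
  case 0
  have "continuous_on UNIV (F j)"
    by (meson F DERIV_isCont continuous_at_imp_continuous_on)
  then show ?case
    by (auto intro!: continuous_on_compose2[of UNIV "F j"] continuous_intros)
next
  case (Suc k)
  have D: "((\<lambda>x. F j (c * (x \<bullet> b) + d)) has_derivative
      (\<lambda>v. F (Suc j) (c * (x \<bullet> b) + d) * (c * (v \<bullet> b)))) (at x)" for x
  proof -
    have "((\<lambda>x. c * (x \<bullet> b) + d) has_derivative (\<lambda>v. c * (v \<bullet> b))) (at x)"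
      by (auto intro!: derivative_eq_intros)
    from has_derivative_compose[OF this F[of j "c * (x \<bullet> b) + d", unfolded has_field_derivative_def]]
    show ?thesis .
  qed
  show ?case
    using D Suc[of "Suc j"]
    by (auto simp: differentiable_on_def differentiable_def frechet_derivative_eqI[OF D]
        intro!: Ck_mult Ck_const) 
qed

text \<open>The classical flat function \<open>exp (- 1 / t)\<close> with polynomial factors in \<open>1 / t\<close>: this family, unlike
  the flat function alone, is closed under differentiation, which gives all derivatives at once.\<close>

definition flat_exp :: "real poly \<Rightarrow> real \<Rightarrow> real" where
  "flat_exp P t = (if 0 < t then poly P (1 / t) * exp (- (1 / t)) else 0)"

lemma poly_over_exp_tendsto_0: "((\<lambda>y. poly P y * exp (- y)) \<longlongrightarrow> (0::real)) at_top"
proof -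
  have "((\<lambda>y. \<Sum>i\<le>degree P. coeff P i * (y ^ i / exp y)) \<longlongrightarrow> (\<Sum>i\<le>degree P. coeff P i * 0)) at_top"
    by (intro tendsto_intros tendsto_power_div_exp_0)
  then show ?thesis
    by (simp add: poly_altdef sum_distrib_right exp_minus field_simps sum_divide_distrib)
qed

text \<open>Away from \<open>0\<close> this is the product rule. At \<open>0\<close> the difference quotient is again of the form
  \<open>Q (1 / t) * exp (- 1 / t)\<close>, which vanishes in the limit because exponentials beat polynomials.\<close>

lemma DERIV_flat_exp:
  "(flat_exp P has_real_derivative flat_exp ([:0, 0, 1:] * (P - pderiv P)) t) (at t)"
proof -
  consider "t < 0" | "t = 0" | "0 < t" by linarith
  then show ?thesis
  proof cases
    case 1
    have "((\<lambda>_. 0) has_real_derivative 0) (at t)" by simp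
    then have "(flat_exp P has_real_derivative 0) (at t)"
      by (rule has_field_derivative_transform_within_open[of _ _ _ "{..<0}"])
         (use 1 in \<open>auto simp: flat_exp_def\<close>)
    then show ?thesis using 1 by (simp add: flat_exp_def)
  next
    case 2
    have "((\<lambda>s. flat_exp P s / s) \<longlongrightarrow> 0) (at_left 0)"
    proof (rule tendsto_eventually)
      show "\<forall>\<^sub>F s in at_left 0. flat_exp P s / s = 0"
        by (auto simp: eventually_at_filter flat_exp_def)
    qed
    moreover have "((\<lambda>s. flat_exp P s / s) \<longlongrightarrow> 0) (at_right 0)"
    proof -
      have "((\<lambda>s. poly ([:0, 1:] * P) (inverse s) * exp (- inverse s)) \<longlongrightarrow> 0) (at_right (0::real))"
        using filterlim_compose[OF poly_over_exp_tendsto_0 filterlim_inverse_at_top_right] .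
      then show ?thesis
        by (rule Lim_transform_eventually)
           (auto simp: eventually_at_filter flat_exp_def field_simps)
    qed
    ultimately have "((\<lambda>s. flat_exp P s / s) \<longlongrightarrow> 0) (at 0)"
      by (simp add: filterlim_at_split)
    then show ?thesis
      using 2 by (simp add: has_field_derivative_iff flat_exp_def)
  next
    case 3
    have "((\<lambda>t. poly P (1 / t) * exp (- (1 / t))) has_real_derivative
        flat_exp ([:0, 0, 1:] * (P - pderiv P)) t) (at t)"
      using 3 by (auto intro!: derivative_eq_intros DERIV_chain2[OF poly_DERIV]
          simp: flat_exp_def field_simps power2_eq_square)
    then show ?thesis
      by (rule has_field_derivative_transform_within_open[of _ _ _ "{0<..}"])
         (use 3 in \<open>auto simp: flat_exp_def\<close>)
  qed
qed

text \<open>A dilated flat function \<open>flat_exp 1 (n * s) = exp (- 1 / (n * s))\<close> increases to \<open>1\<close> as \<open>n\<close> grows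
  whenever \<open>s > 0\<close>. Products of such factors are therefore smooth functions between \<open>0\<close> and \<open>1\<close>,
  supported in a fixed box, that converge to the indicator of the open box.\<close>

definition box_bump :: "real \<Rightarrow> 'a \<Rightarrow> 'a \<Rightarrow> 'a::euclidean_space \<Rightarrow> real" where
  "box_bump n a b x =
     (\<Prod>i\<in>Basis. flat_exp 1 (n * (x \<bullet> i - a \<bullet> i)) * flat_exp 1 (n * (b \<bullet> i - x \<bullet> i)))"

lemma Ck_flat_exp_affine: "Ck k (\<lambda>x. flat_exp P (c * (x \<bullet> b) + d))"
proof -
  define F where "F j = flat_exp (((\<lambda>P. [:0, 0, 1:] * (P - pderiv P)) ^^ j) P)" for j
  have "Ck k (\<lambda>x. F 0 (c * (x \<bullet> b) + d))"
    by (rule Ck_compose_affine) (simp add: F_def DERIV_flat_exp del: mult_pCons_left)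
  then show ?thesis by (simp add: F_def)
qed

lemma Ck_box_bump: "Ck k (box_bump n a b)"
proof -
  have "Ck k (\<lambda>x. flat_exp 1 (n * (x \<bullet> i) + (- n * (a \<bullet> i))) * flat_exp 1 ((-n) * (x \<bullet> i) + n * (b \<bullet> i)))"
    for i :: 'a
    by (intro Ck_mult Ck_flat_exp_affine)
  then have "Ck k (\<lambda>x. \<Prod>i\<in>Basis. flat_exp 1 (n * (x \<bullet> i) + (- n * (a \<bullet> i)))
      * flat_exp 1 ((-n) * (x \<bullet> i) + n * (b \<bullet> i)))"
    by (intro Ck_prod) auto
  then show ?thesis
    by (simp add: box_bump_def[abs_def] algebra_simps)
qed

lemma flat_exp_1_bounds: "0 \<le> flat_exp 1 t" "flat_exp 1 t \<le> 1"
  by (auto simp: flat_exp_def)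

lemma box_bump_bounds: "0 \<le> box_bump n a b x" "box_bump n a b x \<le> 1"
  by (auto simp: box_bump_def flat_exp_1_bounds intro!: prod_nonneg prod_le_1 mult_le_one)

lemma box_bump_outside:
  assumes "0 \<le> n" "x \<notin> box a b"
  shows "box_bump n a b x = 0"
proof -
  obtain i where i: "i \<in> Basis" "x \<bullet> i \<le> a \<bullet> i \<or> b \<bullet> i \<le> x \<bullet> i"
    using assms by (auto simp: mem_box not_less)
  then have "n * (x \<bullet> i - a \<bullet> i) \<le> 0 \<or> n * (b \<bullet> i - x \<bullet> i) \<le> 0"
    using assms(1) by (auto intro!: mult_nonneg_nonpos)
  then show ?thesis
    using i(1) unfolding box_bump_def
    by (intro prod_zero) (auto simp: flat_exp_def intro!: bexI[of _ i])
qed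

lemma box_bump_tendsto_indicator:
  "(\<lambda>n. box_bump (real n) a b x) \<longlonglongrightarrow> indicator (box a b) x"
proof (cases "x \<in> box a b")
  case True
  have "(\<lambda>n. flat_exp 1 (real n * t)) \<longlonglongrightarrow> 1" if "0 < t" for t
  proof -
    have "filterlim (\<lambda>n. real n * t) at_top sequentially"
      using that by (rule filterlim_at_top_mult_tendsto_pos[OF tendsto_const _ filterlim_real_sequentially])
    then have "(\<lambda>n. exp (- (inverse (real n * t)))) \<longlonglongrightarrow> exp (- 0)"
      by (intro tendsto_intros tendsto_inverse_0_at_top)
    then have "(\<lambda>n. exp (- (inverse (real n * t)))) \<longlonglongrightarrow> 1" by simp
    then show ?thesis
    proof (rule Lim_transform_eventually)
      show "\<forall>\<^sub>F n in sequentially. exp (- inverse (real n * t)) = flat_exp 1 (real n * t)"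
        using eventually_gt_at_top[of 0]
        by eventually_elim (use that in \<open>auto simp: flat_exp_def inverse_eq_divide\<close>)
    qed
  qed
  then have "(\<lambda>n. box_bump (real n) a b x) \<longlonglongrightarrow> (\<Prod>i\<in>(Basis::'a set). 1 * 1)"
    unfolding box_bump_def using True by (intro tendsto_prod tendsto_mult) (auto simp: mem_box)
  then show ?thesis using True by simp
next
  case False
  then show ?thesis by (simp add: box_bump_outside)
qed

lemma box_bump_test_function:
  assumes "0 \<le> n" "cbox a b \<subseteq> \<Omega>"
  shows "box_bump n a b \<in> test_functions \<Omega>"
proof -
  have "{x. box_bump n a b x \<noteq> 0} \<subseteq> cbox a b"
    using box_bump_outside[OF assms(1)] box_subset_cbox by blast
  then have "closure {x. box_bump n a b x \<noteq> 0} \<subseteq> cbox a b"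
    by (rule closure_minimal) (rule closed_cbox)
  then have "compact (closure {x. box_bump n a b x \<noteq> 0})" "closure {x. box_bump n a b x \<noteq> 0} \<subseteq> \<Omega>"
    using assms(2) bounded_subset[OF bounded_cbox] by (auto simp only: compact_eq_bounded_closed closed_closure)
  then show ?thesis
    by (simp add: test_functions_def Ck_box_bump)
qed

section \<open>Differentiation under the integral sign\<close>

text \<open>Dominated convergence of the difference quotients. The integrable bound \<open>w\<close> plays the part of a
  local Lipschitz constant of \<open>t \<mapsto> f t x\<close>; in the applications it comes from the mean value theorem.\<close>

lemma
  fixes f :: "real \<Rightarrow> 'a \<Rightarrow> real"
  assumes f: "\<And>t. integrable M (f t)"
    and f': "f' \<in> borel_measurable M"
    and w: "integrable M w"
    and der: "AE x in M. ((\<lambda>t. f t x) has_real_derivative f' x) (at 0)"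
    and bound: "\<And>t. \<bar>t\<bar> \<le> 1 \<Longrightarrow> AE x in M. \<bar>f t x - f 0 x\<bar> \<le> \<bar>t\<bar> * w x"
  shows integrable_derivative_dominated: "integrable M f'" (is ?int)
    and has_derivative_integral_dominated:
      "((\<lambda>t. \<integral>x. f t x \<partial>M) has_real_derivative (\<integral>x. f' x \<partial>M)) (at 0)" (is ?deriv)
proof -
  have *: "integrable M f' \<and> ((\<lambda>i. ((\<integral>x. f (X i) x \<partial>M) - (\<integral>x. f 0 x \<partial>M)) / X i) \<longlonglongrightarrow> (\<integral>x. f' x \<partial>M))"
    if X0: "\<And>i. X i \<noteq> 0" and X: "X \<longlonglongrightarrow> 0" for X :: "nat \<Rightarrow> real"
  proof -
    \<comment> \<open>The bound is only available for parameters of modulus at most one, which excludes finitely many \<open>X i\<close>.\<close>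
    define Y where "Y i = (if \<bar>X i\<bar> \<le> 1 then X i else 1)" for i
    have XY: "\<forall>\<^sub>F i in sequentially. Y i = X i"
      using tendstoD[OF X zero_less_one] by eventually_elim (auto simp: Y_def)
    have Y: "Y \<longlonglongrightarrow> 0" "\<And>i. Y i \<noteq> 0" "\<And>i. \<bar>Y i\<bar> \<le> 1"
    proof -
      show "Y \<longlonglongrightarrow> 0"
        by (rule Lim_transform_eventually[OF X]) (use XY in eventually_elim, simp)
    qed (auto simp: Y_def X0)
    define s where "s i x = (f (Y i) x - f 0 x) / Y i" for i x
    have "AE x in M. (\<lambda>i. s i x) \<longlonglongrightarrow> f' x"
      using der
    proof eventually_elim
      case (elim x)
      then have "((\<lambda>h. (f h x - f 0 x) / h) \<longlongrightarrow> f' x) (at 0)"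
        by (simp add: has_field_derivative_iff)
      moreover have "filterlim Y (at 0) sequentially"
        using Y by (simp add: filterlim_at)
      ultimately show ?case
        unfolding s_def by (rule filterlim_compose)
    qed
    moreover have "AE x in M. norm (s i x) \<le> w x" for i
      using bound[OF Y(3)[of i]]
    proof eventually_elim
      case (elim x)
      then show ?case using Y(2)[of i]
        by (simp add: s_def abs_divide divide_le_eq mult.commute)
    qed
    moreover have "s i \<in> borel_measurable M" for i
      using f unfolding s_def by (intro borel_measurable_divide borel_measurable_diff) auto
    ultimately have "integrable M f'" and lim: "(\<lambda>i. integral\<^sup>L M (s i)) \<longlonglongrightarrow> integral\<^sup>L M f'"
      using integrable_dominated_convergence[OF f' _ w] integral_dominated_convergence[OF f' _ w]
      by blast+
    moreover have "integral\<^sup>L M (s i) = ((\<integral>x. f (Y i) x \<partial>M) - (\<integral>x. f 0 x \<partial>M)) / Y i" for i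
      unfolding s_def by (simp add: f)
    moreover have "\<forall>\<^sub>F i in sequentially. ((\<integral>x. f (Y i) x \<partial>M) - (\<integral>x. f 0 x \<partial>M)) / Y i
        = ((\<integral>x. f (X i) x \<partial>M) - (\<integral>x. f 0 x \<partial>M)) / X i"
      using XY by eventually_elim simp
    ultimately show ?thesis
      using Lim_transform_eventually by force
  qed
  show ?int
    using *[of "\<lambda>i. inverse (real (Suc i))"] LIMSEQ_inverse_real_of_nat by simp
  show ?deriv
    unfolding has_field_derivative_iff tendsto_at_iff_sequentially comp_def
    using * by auto
qed

section \<open>Test functions and the fundamental lemma of the calculus of variations\<close>

lemma test_function_Ck: "\<psi> \<in> test_functions \<Omega> \<Longrightarrow> Ck k \<psi>"
  by (simp add: test_functions_def)

lemma test_function_has_derivative: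
  "\<psi> \<in> test_functions \<Omega> \<Longrightarrow> (\<psi> has_derivative frechet_derivative \<psi> (at x)) (at x)"
  using test_function_Ck[of \<psi> \<Omega> "Suc 0"]
  by (auto simp: frechet_derivative_works[symmetric] differentiable_on_def)

lemma test_function_continuous: "\<psi> \<in> test_functions \<Omega> \<Longrightarrow> continuous_on UNIV \<psi>"
  using test_function_Ck[of \<psi> \<Omega> 0] by simp

lemma test_function_continuous_partial:
  "\<psi> \<in> test_functions \<Omega> \<Longrightarrow> i \<in> Basis \<Longrightarrow> continuous_on UNIV (\<lambda>x. frechet_derivative \<psi> (at x) i)"
  using test_function_Ck[of \<psi> \<Omega> "Suc 0"] by simp

lemma test_function_support:
  assumes "\<psi> \<in> test_functions \<Omega>"
  obtains K where "compact K" "K \<subseteq> \<Omega>" "\<And>x. x \<notin> K \<Longrightarrow> \<psi> x = 0"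
    "\<And>x. x \<notin> K \<Longrightarrow> frechet_derivative \<psi> (at x) = (\<lambda>_. 0)"
proof
  let ?K = "closure {x. \<psi> x \<noteq> 0}"
  show "compact ?K" "?K \<subseteq> \<Omega>" using assms by (auto simp: test_functions_def)
  show "\<psi> x = 0" if "x \<notin> ?K" for x
    using that closure_subset[of "{x. \<psi> x \<noteq> 0}"] by auto
  show "frechet_derivative \<psi> (at x) = (\<lambda>_. 0)" if "x \<notin> ?K" for x
  proof (rule frechet_derivative_eqI)
    have "((\<lambda>_. 0) has_derivative (\<lambda>_. 0)) (at x)" by simp
    then show "(\<psi> has_derivative (\<lambda>_. 0)) (at x)"
      by (rule has_derivative_transform_within_open[of _ _ _ _ "- ?K"])
         (use that closure_subset[of "{x. \<psi> x \<noteq> 0}"] in \<open>auto simp: open_Compl\<close>)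
  qed
qed

lemma test_function_diff_cmult:
  assumes "\<psi> \<in> test_functions \<Omega>" "\<eta> \<in> test_functions \<Omega>"
  shows "(\<lambda>x. \<psi> x - c * \<eta> x) \<in> test_functions \<Omega>"
proof -
  have "Ck k (\<lambda>x. \<psi> x - c * \<eta> x)" for k
    using Ck_add[OF test_function_Ck[OF assms(1)] Ck_mult[OF Ck_const[of k "- c"] test_function_Ck[OF assms(2)]]]
    by simp
  moreover
  have sub: "closure {x. \<psi> x - c * \<eta> x \<noteq> 0} \<subseteq> closure {x. \<psi> x \<noteq> 0} \<union> closure {x. \<eta> x \<noteq> 0}"
    unfolding closure_Un[symmetric] by (rule closure_mono) auto
  moreover have "compact (closure {x. \<psi> x \<noteq> 0} \<union> closure {x. \<eta> x \<noteq> 0})"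
    using assms by (auto simp: test_functions_def)
  ultimately show ?thesis
    using assms compact_Int_closed[of "closure {x. \<psi> x \<noteq> 0} \<union> closure {x. \<eta> x \<noteq> 0}" "closure {x. \<psi> x - c * \<eta> x \<noteq> 0}"]
    by (auto simp: test_functions_def inf_absorb2)
qed

lemma test_function_mult:
  assumes "\<psi> \<in> test_functions \<Omega>" "\<eta> \<in> test_functions \<Omega>"
  shows "(\<lambda>x. \<psi> x * \<eta> x) \<in> test_functions \<Omega>"
proof -
  have "Ck k (\<lambda>x. \<psi> x * \<eta> x)" for k
    using Ck_mult test_function_Ck assms by blast
  moreover
  have sub: "closure {x. \<psi> x * \<eta> x \<noteq> 0} \<subseteq> closure {x. \<psi> x \<noteq> 0}"
    by (rule closure_mono) auto
  ultimately show ?thesis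
    using assms compact_Int_closed[of "closure {x. \<psi> x \<noteq> 0}" "closure {x. \<psi> x * \<eta> x \<noteq> 0}"]
    by (auto simp: test_functions_def inf_absorb2)
qed

lemma continuous_compact_support_bounded:
  fixes f :: "'a::metric_space \<Rightarrow> real"
  assumes "continuous_on UNIV f" "compact K" "\<And>x. x \<notin> K \<Longrightarrow> f x = 0"
  obtains B where "0 \<le> B" "\<And>x. \<bar>f x\<bar> \<le> B"
proof -
  have "bounded (f ` K)"
    using assms by (intro compact_imp_bounded compact_continuous_image continuous_on_subset[OF assms(1)]) auto
  then obtain B where B: "\<And>x. x \<in> K \<Longrightarrow> \<bar>f x\<bar> \<le> B"
    by (auto simp: bounded_iff)
  show thesis
    by (rule that[of "max 0 B"]) (use B assms(3) in \<open>force simp: max_def\<close>)+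
qed

lemma borel_measurable_lebesgue_on_continuous:
  fixes f :: "'a::euclidean_space \<Rightarrow> 'b::euclidean_space"
  assumes "continuous_on UNIV f"
  shows "f \<in> borel_measurable (lebesgue_on S)"
  by (intro measurable_restrict_space1 measurable_completion)
     (simp add: assms borel_measurable_continuous_onI)

text \<open>Local integrability suffices to integrate against a continuous factor that lives on a compact
  part of \<open>\<Omega>\<close>; this makes every integral in the definition of weak gradients meaningful.\<close>

lemma integrable_mult_compact_support:
  fixes u f :: "'a::euclidean_space \<Rightarrow> real"
  assumes \<Omega>: "open \<Omega>" and u: "set_integrable lebesgue K u"
    and f: "continuous_on UNIV f" "compact K" "K \<subseteq> \<Omega>" "\<And>x. x \<notin> K \<Longrightarrow> f x = 0"
  shows "integrable (lebesgue_on \<Omega>) (\<lambda>x. u x * f x)"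
proof -
  obtain B where B: "\<And>x. \<bar>f x\<bar> \<le> B"
    using continuous_compact_support_bounded[OF f(1,2,4)] by metis
  have eq: "(\<lambda>x. indicator \<Omega> x *\<^sub>R (u x * f x)) = (\<lambda>x. (indicator K x *\<^sub>R u x) * f x)"
    using f(3,4) by (fastforce simp: indicator_def)
  have fm: "f \<in> borel_measurable lebesgue"
    using borel_measurable_lebesgue_on_continuous[OF f(1), of UNIV] by (simp add: lebesgue_on_UNIV_eq)
  have "integrable lebesgue (\<lambda>x. (indicator K x *\<^sub>R u x) * f x)"
  proof (rule Bochner_Integration.integrable_bound)
    show "integrable lebesgue (\<lambda>x. B * (indicator K x *\<^sub>R u x))"
      using u by (intro integrable_mult_right) (simp add: set_integrable_def)
    show "(\<lambda>x. (indicator K x *\<^sub>R u x) * f x) \<in> borel_measurable lebesgue"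
      using u fm by (intro borel_measurable_times) (auto simp: set_integrable_def)
    have "\<bar>a * f x\<bar> \<le> \<bar>B * a\<bar>" for a x
      using mult_right_mono[OF B[of x], of "\<bar>a\<bar>"] B[of x] by (simp add: abs_mult mult.commute)
    then show "AE x in lebesgue. norm ((indicator K x *\<^sub>R u x) * f x) \<le> norm (B * (indicator K x *\<^sub>R u x))"
      by simp
  qed
  then show ?thesis
    using \<Omega> by (subst integrable_restrict_space) (auto simp: eq simp del: real_scaleR_def)
qed

text \<open>The bumps on the box are admissible test functions and converge boundedly to its indicator.\<close>

lemma set_integral_box_zero_if_orthogonal:
  fixes f :: "'a::euclidean_space \<Rightarrow> real"
  assumes \<Omega>: "open \<Omega>" and f: "\<And>K. compact K \<Longrightarrow> K \<subseteq> \<Omega> \<Longrightarrow> set_integrable lebesgue K f"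
    and orth: "\<And>\<psi>. \<psi> \<in> test_functions \<Omega> \<Longrightarrow> (\<integral>x. f x * \<psi> x \<partial>lebesgue_on \<Omega>) = 0"
    and box: "cbox a b \<subseteq> \<Omega>"
  shows "(LINT x:box a b|lebesgue. f x) = 0"
proof -
  let ?g = "\<lambda>x. indicator (cbox a b) x *\<^sub>R f x"
  have g: "integrable lebesgue ?g"
    using f[OF compact_cbox box] by (simp add: set_integrable_def)
  have bump_m: "box_bump (real n) a b \<in> borel_measurable lebesgue" for n
    using borel_measurable_lebesgue_on_continuous[OF test_function_continuous[OF box_bump_test_function[OF _ box]], of n UNIV]
    by (simp add: lebesgue_on_UNIV_eq)
  have "(\<lambda>n. \<integral>x. ?g x * box_bump (real n) a b x \<partial>lebesgue) \<longlonglongrightarrow> (\<integral>x. ?g x * indicator (box a b) x \<partial>lebesgue)"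
  proof (rule integral_dominated_convergence[where w = "\<lambda>x. norm (?g x)"])
    show "AE x in lebesgue. (\<lambda>n. ?g x * box_bump (real n) a b x) \<longlonglongrightarrow> ?g x * indicator (box a b) x"
      by (intro always_eventually allI tendsto_intros box_bump_tendsto_indicator)
    show "AE x in lebesgue. norm (?g x * box_bump (real n) a b x) \<le> norm (?g x)" for n
      using box_bump_bounds[of n a b] by (auto simp: abs_mult mult_left_le)
    show "(\<lambda>x. ?g x * indicator (box a b) x) \<in> borel_measurable lebesgue"
      by (intro borel_measurable_times borel_measurable_integrable[OF g] borel_measurable_indicator) simp
    show "(\<lambda>x. ?g x * box_bump (real n) a b x) \<in> borel_measurable lebesgue" for n
      using borel_measurable_integrable[OF g] bump_m by (rule borel_measurable_times)
  qed (rule integrable_norm[OF g])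
  moreover have "(\<integral>x. ?g x * box_bump (real n) a b x \<partial>lebesgue) = 0" for n
  proof -
    have "(\<lambda>x. ?g x * box_bump (real n) a b x) = (\<lambda>x. indicator \<Omega> x *\<^sub>R (f x * box_bump (real n) a b x))"
      using box box_bump_outside[of "real n" _ a b] box_subset_cbox[of a b] by (fastforce simp: indicator_def)
    then have "(\<integral>x. ?g x * box_bump (real n) a b x \<partial>lebesgue) = (\<integral>x. f x * box_bump (real n) a b x \<partial>lebesgue_on \<Omega>)"
      using \<Omega> by (subst integral_restrict_space) auto
    then show ?thesis
      using orth[OF box_bump_test_function[OF _ box]] by simp
  qed
  moreover have "(\<lambda>x. ?g x * indicator (box a b) x) = (\<lambda>x. indicator (box a b) x *\<^sub>R f x)"
    using box_subset_cbox[of a b] by (auto simp: indicator_def fun_eq_iff)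
  ultimately show ?thesis
    by (simp add: set_lebesgue_integral_def LIMSEQ_const_iff)
qed

text \<open>Boxes are an intersection-stable generator of the Borel sets, and the sets over which the integral
  of \<open>f\<close> vanishes form a Dynkin system.\<close>

lemma AE_lborel_zero_if_box_integrals_zero:
  fixes f :: "'a::euclidean_space \<Rightarrow> real"
  assumes f: "integrable lborel f" and tot: "integral\<^sup>L lborel f = 0"
    and box: "\<And>a b. (LINT x:box a b|lborel. f x) = 0"
  shows "AE x in lborel. f x = 0"
proof (rule sigma_finite_measure.density_zero[OF lborel.sigma_finite_measure_axioms f])
  have int: "set_integrable lborel A f" if "A \<in> sets borel" for A
    using that f unfolding set_integrable_def by (intro integrable_mult_indicator) auto
  let ?E = "range (\<lambda>(a, b). box a b :: 'a set)"
  fix A :: "'a set" assume "A \<in> sets lborel"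
  then have "A \<in> sigma_sets UNIV ?E" by (simp add: borel_eq_box)
  have "Int_stable ?E" by (auto simp: Int_stable_def box_Int_box)
  moreover have "?E \<subseteq> Pow UNIV" by simp
  moreover note \<open>A \<in> sigma_sets UNIV ?E\<close>
  ultimately show "(LINT x:A|lborel. f x) = 0"
  proof (induction rule: sigma_sets_induct_disjoint)
    case (basic A)
    then show ?case using box by auto
  next
    case empty
    then show ?case by (simp add: set_lebesgue_integral_def)
  next
    case (compl A)
    then have A: "A \<in> sets borel" by (simp add: borel_eq_box)
    have "(\<lambda>x. indicator (UNIV - A) x *\<^sub>R f x) = (\<lambda>x. f x - indicator A x *\<^sub>R f x)"
      by (auto simp: indicator_def)
    then show ?case
      using compl int[OF A] f tot by (simp add: set_lebesgue_integral_def set_integrable_def)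
  next
    case (union A)
    then have A: "A i \<in> sets borel" for i by (auto simp: borel_eq_box)
    have "(LINT x:(\<Union>i. A i)|lborel. f x) = (\<Sum>i. (LINT x:A i|lborel. f x))"
      using union A int by (intro lebesgue_integral_countable_add) (auto simp: disjoint_family_on_def)
    then show ?case using union by simp
  qed
qed

text \<open>The fundamental lemma of the calculus of variations. On a box whose closure lies in \<open>\<Omega>\<close> the
  function is integrable and all its integrals over subboxes vanish; countably many closed boxes
  exhaust \<open>\<Omega>\<close>.\<close>

lemma AE_zero_if_orthogonal_to_test_functions:
  fixes f :: "'a::euclidean_space \<Rightarrow> real"
  assumes \<Omega>: "open \<Omega>" and f: "\<And>K. compact K \<Longrightarrow> K \<subseteq> \<Omega> \<Longrightarrow> set_integrable lebesgue K f"
    and orth: "\<And>\<psi>. \<psi> \<in> test_functions \<Omega> \<Longrightarrow> (\<integral>x. f x * \<psi> x \<partial>lebesgue_on \<Omega>) = 0"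
  shows "AE x in lebesgue_on \<Omega>. f x = 0"
proof -
  have box0: "AE x in lebesgue. x \<in> cbox a b \<longrightarrow> f x = 0" if ab: "cbox a b \<subseteq> \<Omega>" for a b
  proof -
    let ?g = "\<lambda>x. indicator (box a b) x *\<^sub>R f x"
    have g: "integrable lebesgue ?g"
      using set_integrable_subset[OF f[OF compact_cbox ab] _ box_subset_cbox]
      by (simp add: set_integrable_def)
    then obtain f' where f'_m: "f' \<in> borel_measurable lborel" and f': "AE x in lborel. ?g x = f' x"
      using completion_ex_borel_measurable_real[of ?g lborel] borel_measurable_integrable by blast
    have f'_l: "f' \<in> borel_measurable lebesgue"
      using f'_m by (rule measurable_completion)
    have gf': "AE x in lebesgue. ?g x = f' x"
      using f' by (rule AE_completion)
    have "integrable lebesgue f'"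
      by (rule integrable_cong_AE_imp[OF g f'_l gf'])
    then have int: "integrable lborel f'"
      using integrable_completion[OF f'_m] by simp
    have zero: "(LINT x:box c d|lborel. f' x) = 0" for c d
    proof -
      obtain l r where lr: "box a b \<inter> box c d = box l r"
        using box_Int_box[of a b c d] by blast
      have "cbox l r \<subseteq> \<Omega> \<or> box l r = {}"
      proof (cases "box l r = {}")
        case False
        have "closure (box l r) \<subseteq> closure (box a b)" "box a b \<noteq> {}"
          using lr False closure_mono[of "box l r" "box a b"] by auto
        then show ?thesis using False ab by (simp add: closure_box)
      qed simp
      then have "(LINT x:box l r|lebesgue. f x) = 0"
        using set_integral_box_zero_if_orthogonal[OF \<Omega> f orth] by (auto simp: set_lebesgue_integral_def)
      moreover have "(LINT x:box c d|lborel. f' x) = (LINT x:box c d|lebesgue. f' x)"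
        unfolding set_lebesgue_integral_def using f'_m by (subst integral_completion) auto
      moreover have "\<dots> = (LINT x:box l r|lebesgue. f x)"
        unfolding set_lebesgue_integral_def lr[symmetric]
      proof (rule integral_cong_AE)
        show "(\<lambda>x. indicator (box a b \<inter> box c d) x *\<^sub>R f x) \<in> borel_measurable lebesgue"
        proof -
          have "(\<lambda>x. indicator (box c d) x *\<^sub>R ?g x) \<in> borel_measurable lebesgue"
            by (intro borel_measurable_scaleR borel_measurable_indicator borel_measurable_integrable[OF g]) simp
          then show ?thesis by (simp add: indicator_inter_arith ac_simps)
        qed
        show "AE x in lebesgue. indicator (box c d) x *\<^sub>R f' x = indicator (box a b \<inter> box c d) x *\<^sub>R f x"
          using gf' by eventually_elim (auto simp: indicator_def)
        show "(\<lambda>x. indicator (box c d) x *\<^sub>R f' x) \<in> borel_measurable lebesgue"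
          by (intro borel_measurable_scaleR borel_measurable_indicator f'_l) simp
      qed
      ultimately show ?thesis by simp
    qed
    have tot: "integral\<^sup>L lborel f' = 0"
    proof -
      have "integral\<^sup>L lborel f' = integral\<^sup>L lebesgue f'"
        using f'_m by (simp add: integral_completion)
      also have "\<dots> = integral\<^sup>L lebesgue ?g"
        using gf' f'_l g by (intro integral_cong_AE) auto
      also have "\<dots> = 0"
        using set_integral_box_zero_if_orthogonal[OF \<Omega> f orth ab] by (simp add: set_lebesgue_integral_def)
      finally show ?thesis .
    qed
    have "AE x in lebesgue. f' x = 0"
      using AE_lborel_zero_if_box_integrals_zero[OF int tot zero] by (rule AE_completion)
    moreover have "AE x in lebesgue. x \<notin> cbox a b - box a b"
      using negligible_frontier_interval[of a b] unfolding negligible_iff_null_sets by (rule AE_not_in)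
    ultimately show ?thesis
      using gf' by eventually_elim (auto simp: indicator_def)
  qed
  obtain D where D: "countable D" "D \<subseteq> Pow \<Omega>" "\<And>X. X \<in> D \<Longrightarrow> \<exists>a b. X = cbox a b" "\<Union>D = \<Omega>"
    using open_countable_Union_open_cbox[OF \<Omega>] by metis
  have "AE x in lebesgue. \<forall>X\<in>D. x \<in> X \<longrightarrow> f x = 0"
    unfolding AE_ball_countable[OF D(1)]
  proof
    fix X assume "X \<in> D"
    moreover from this obtain a b where "X = cbox a b" using D(3) by blast
    ultimately show "AE x in lebesgue. x \<in> X \<longrightarrow> f x = 0"
      using D(2) box0[of a b] by auto
  qed
  then have "AE x in lebesgue. x \<in> \<Omega> \<longrightarrow> f x = 0"
    by eventually_elim (use D(4) in auto)
  then show ?thesis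
    using \<Omega> by (simp add: AE_restrict_space_iff)
qed

text \<open>The integral of \<open>\<psi>\<close> over the whole space is invariant under translations. Differentiating
  the integral of \<open>\<psi> (t *\<^sub>R i + x)\<close> under the integral sign at \<open>t = 0\<close> gives the claim. Applied to a product of test functions it is integration by parts.\<close>

lemma integral_partial_test_function_zero:
  assumes \<Omega>: "open \<Omega>" and \<psi>: "\<psi> \<in> test_functions \<Omega>" and i: "i \<in> Basis"
  shows "(\<integral>x. frechet_derivative \<psi> (at x) i \<partial>lebesgue_on \<Omega>) = 0"
proof -
  let ?d = "\<lambda>x. frechet_derivative \<psi> (at x) i"
  obtain K where K: "compact K" "K \<subseteq> \<Omega>" "\<And>x. x \<notin> K \<Longrightarrow> \<psi> x = 0" "\<And>x. x \<notin> K \<Longrightarrow> ?d x = 0"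
    using test_function_support[OF \<psi>] by metis
  have d_cont: "continuous_on UNIV ?d"
    by (rule test_function_continuous_partial[OF \<psi> i])
  obtain B where B: "0 \<le> B" "\<And>x. \<bar>?d x\<bar> \<le> B"
    using continuous_compact_support_bounded[OF d_cont K(1,4)] by metis
  obtain C where C: "\<And>x. \<bar>\<psi> x\<bar> \<le> C"
    using continuous_compact_support_bounded[OF test_function_continuous[OF \<psi>] K(1,3)] by metis
  obtain R where R: "K \<subseteq> cball 0 R"
    using compact_imp_bounded[OF K(1)] using bounded_subset_ballD[of K 0] ball_subset_cball by blast
  have \<psi>_m: "\<psi> \<in> borel_measurable borel"
    by (rule borel_measurable_continuous_onI[OF test_function_continuous[OF \<psi>]])
  have int: "integrable lborel \<psi>"
  proof (rule Bochner_Integration.integrable_bound)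
    show "integrable lborel (\<lambda>x. C * indicator K x :: real)"
      using K(1) by (intro integrable_mult_right integrable_real_indicator) (use emeasure_compact_finite in \<open>auto simp: borel_compact\<close>)
    show "AE x in lborel. norm (\<psi> x) \<le> norm (C * indicator K x :: real)"
    proof (intro always_eventually allI)
      show "norm (\<psi> x) \<le> norm (C * indicator K x :: real)" for x
        using C[of x] K(3)[of x] by (cases "x \<in> K") auto
    qed
  qed (use \<psi>_m in auto)
  have shift: "integrable lborel (\<lambda>x. \<psi> (t *\<^sub>R i + x))"
    "(\<integral>x. \<psi> (t *\<^sub>R i + x) \<partial>lborel) = integral\<^sup>L lborel \<psi>" for t
  proof -
    show "integrable lborel (\<lambda>x. \<psi> (t *\<^sub>R i + x))"
      using int \<psi>_m integrable_distr_eq[of "(+) (t *\<^sub>R i)" lborel borel \<psi>] by (simp add: lborel_distr_plus)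
    show "(\<integral>x. \<psi> (t *\<^sub>R i + x) \<partial>lborel) = integral\<^sup>L lborel \<psi>"
      using \<psi>_m integral_distr[of "(+) (t *\<^sub>R i)" lborel borel \<psi>] by (simp add: lborel_distr_plus)
  qed
  have der: "((\<lambda>t. \<psi> (t *\<^sub>R i + x)) has_real_derivative ?d (s *\<^sub>R i + x)) (at s)" for s x
  proof -
    have "((\<lambda>t. t *\<^sub>R i + x) has_derivative (\<lambda>h. h *\<^sub>R i)) (at s)"
      by (auto intro!: derivative_eq_intros)
    from has_derivative_compose[OF this test_function_has_derivative[OF \<psi>]]
    show ?thesis
      using linear_scale[OF has_derivative_linear[OF test_function_has_derivative[OF \<psi>, of "s *\<^sub>R i + x"]]]
      by (simp add: has_field_derivative_def mult_commute_abs)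
  qed
  \<comment> \<open>Shifts by at most one keep the support inside the ball of radius \<open>R + 1\<close>.\<close>
  have bound: "\<bar>\<psi> (t *\<^sub>R i + x) - \<psi> (0 *\<^sub>R i + x)\<bar> \<le> \<bar>t\<bar> * (B * indicator (cball 0 (R + 1)) x)"
    if t: "\<bar>t\<bar> \<le> 1" for t x
  proof (cases "x \<in> cball 0 (R + 1)")
    case True
    have "norm (\<psi> (t *\<^sub>R i + x) - \<psi> (0 *\<^sub>R i + x)) \<le> B * norm (t - 0)"
      by (rule field_differentiable_bound[of UNIV _ "\<lambda>s. ?d (s *\<^sub>R i + x)"]) (use der B in auto)
    then show ?thesis using True by (simp add: mult.commute)
  next
    case False
    have "norm (t *\<^sub>R i) \<le> 1" using t i by simp
    then have "norm (t *\<^sub>R i + x) > R"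
      using False norm_triangle_ineq2[of x "- (t *\<^sub>R i)"] by (simp add: add.commute)
    then have "t *\<^sub>R i + x \<notin> K" "x \<notin> K" using R False by auto
    then show ?thesis using K(3) False by simp
  qed
  have "((\<lambda>t. \<integral>x. \<psi> (t *\<^sub>R i + x) \<partial>lborel) has_real_derivative (\<integral>x. ?d x \<partial>lborel)) (at 0)"
  proof (rule has_derivative_integral_dominated)
    show "?d \<in> borel_measurable lborel"
      using borel_measurable_continuous_onI[OF d_cont] by simp
    show "integrable lborel (\<lambda>x. B * indicator (cball 0 (R + 1)) x :: real)"
      by (intro integrable_mult_right integrable_real_indicator) (use emeasure_compact_finite[OF compact_cball] in auto)
    show "AE x in lborel. ((\<lambda>t. \<psi> (t *\<^sub>R i + x)) has_real_derivative ?d x) (at 0)"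
      using der[of _ 0] by simp
  qed (use shift bound in auto)
  then have "(\<integral>x. ?d x \<partial>lborel) = 0"
    unfolding shift by (rule DERIV_unique) simp
  moreover have "(\<integral>x. ?d x \<partial>lebesgue_on \<Omega>) = (\<integral>x. ?d x \<partial>lborel)"
  proof -
    have "(\<lambda>x. indicator \<Omega> x *\<^sub>R ?d x) = ?d"
      using K(2,4) by (fastforce simp: indicator_def)
    then have "(\<integral>x. ?d x \<partial>lebesgue_on \<Omega>) = (\<integral>x. ?d x \<partial>lebesgue)"
      using \<Omega> by (subst integral_restrict_space) auto
    then show ?thesis
      using borel_measurable_continuous_onI[OF d_cont] by (simp add: integral_completion)
  qed
  ultimately show ?thesis by simp
qed

section \<open>Weak gradients\<close>

lemma has_weak_gradient_integrable:
  assumes "has_weak_gradient \<Omega> u g" "compact K" "K \<subseteq> \<Omega>"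
  shows "set_integrable lebesgue K u" "set_integrable lebesgue K g" "set_integrable lebesgue K (\<lambda>x. g x \<bullet> i)"
proof -
  show "set_integrable lebesgue K u" and g: "set_integrable lebesgue K g"
    using assms by (auto simp: has_weak_gradient_def)
  show "set_integrable lebesgue K (\<lambda>x. g x \<bullet> i)"
    using integrable_inner_left[of i, OF g[unfolded set_integrable_def]]
    by (simp add: set_integrable_def)
qed

lemma has_weak_gradient_integrable_test:
  assumes \<Omega>: "open \<Omega>" and g: "has_weak_gradient \<Omega> u g" and \<psi>: "\<psi> \<in> test_functions \<Omega>"
  shows "integrable (lebesgue_on \<Omega>) (\<lambda>x. (g x \<bullet> i) * \<psi> x)"
    and "i \<in> Basis \<Longrightarrow> integrable (lebesgue_on \<Omega>) (\<lambda>x. u x * frechet_derivative \<psi> (at x) i)"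
proof -
  obtain K where K: "compact K" "K \<subseteq> \<Omega>" "\<And>x. x \<notin> K \<Longrightarrow> \<psi> x = 0"
    "\<And>x. x \<notin> K \<Longrightarrow> frechet_derivative \<psi> (at x) = (\<lambda>_. 0)"
    using test_function_support[OF \<psi>] by metis
  show "integrable (lebesgue_on \<Omega>) (\<lambda>x. (g x \<bullet> i) * \<psi> x)"
    by (rule integrable_mult_compact_support[OF \<Omega> has_weak_gradient_integrable(3)[OF g K(1,2)]
          test_function_continuous[OF \<psi>] K(1,2,3)])
  show "integrable (lebesgue_on \<Omega>) (\<lambda>x. u x * frechet_derivative \<psi> (at x) i)" if "i \<in> Basis"
    by (rule integrable_mult_compact_support[OF \<Omega> has_weak_gradient_integrable(1)[OF g K(1,2)]
          test_function_continuous_partial[OF \<psi> that] K(1,2)]) (simp add: K(4))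
qed

text \<open>Each component of the difference of two weak gradients is orthogonal to all test functions. Only
  through this uniqueness does the chosen representative \<open>weak_grad\<close> become linear, up to null sets.\<close>

lemma has_weak_gradient_unique:
  assumes \<Omega>: "open \<Omega>" and g: "has_weak_gradient \<Omega> u g" and k: "has_weak_gradient \<Omega> u k"
  shows "AE x in lebesgue_on \<Omega>. g x = k x"
proof -
  have "AE x in lebesgue_on \<Omega>. g x \<bullet> i - k x \<bullet> i = 0" if i: "i \<in> Basis" for i
  proof (rule AE_zero_if_orthogonal_to_test_functions[OF \<Omega>])
    show "set_integrable lebesgue K (\<lambda>x. g x \<bullet> i - k x \<bullet> i)" if "compact K" "K \<subseteq> \<Omega>" for K
      using has_weak_gradient_integrable(3)[OF g that] has_weak_gradient_integrable(3)[OF k that]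
      by (rule set_integral_diff)
    show "(\<integral>x. (g x \<bullet> i - k x \<bullet> i) * \<psi> x \<partial>lebesgue_on \<Omega>) = 0" if \<psi>: "\<psi> \<in> test_functions \<Omega>" for \<psi>
    proof -
      have "(\<integral>x. (g x \<bullet> i) * \<psi> x \<partial>lebesgue_on \<Omega>) = (\<integral>x. (k x \<bullet> i) * \<psi> x \<partial>lebesgue_on \<Omega>)"
      proof -
        have "- (\<integral>x. (g x \<bullet> i) * \<psi> x \<partial>lebesgue_on \<Omega>) = - (\<integral>x. (k x \<bullet> i) * \<psi> x \<partial>lebesgue_on \<Omega>)"
          using g k \<psi> i by (simp add: has_weak_gradient_def)
        then show ?thesis by linarith
      qed
      then show ?thesis
        using has_weak_gradient_integrable_test(1)[OF \<Omega> g \<psi>] has_weak_gradient_integrable_test(1)[OF \<Omega> k \<psi>]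
        by (simp add: left_diff_distrib)
    qed
  qed
  then have "AE x in lebesgue_on \<Omega>. \<forall>i\<in>Basis. g x \<bullet> i - k x \<bullet> i = 0"
    by (subst AE_finite_all) auto
  then show ?thesis
    by eventually_elim (auto intro: euclidean_eqI)
qed

lemma has_weak_gradient_diff_cmult:
  fixes u v :: "'a::euclidean_space \<Rightarrow> real"
  assumes \<Omega>: "open \<Omega>" and u: "has_weak_gradient \<Omega> u g" and v: "has_weak_gradient \<Omega> v k"
  shows "has_weak_gradient \<Omega> (\<lambda>x. u x - c * v x) (\<lambda>x. g x - c *\<^sub>R k x)"
  unfolding has_weak_gradient_def
proof (intro conjI allI impI ballI)
  fix K assume "compact K \<and> K \<subseteq> \<Omega>"
  then have K: "compact K" "K \<subseteq> \<Omega>" by auto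
  note iu = has_weak_gradient_integrable[OF u K] and iv = has_weak_gradient_integrable[OF v K]
  show "set_integrable lebesgue K (\<lambda>x. u x - c * v x)"
    by (intro set_integral_diff iu set_integrable_mult_right iv)
  show "set_integrable lebesgue K (\<lambda>x. g x - c *\<^sub>R k x)"
    by (intro set_integral_diff iu set_integrable_scaleR_right iv)
next
  fix \<psi> :: "'a \<Rightarrow> real" and i :: 'a
  assume \<psi>: "\<psi> \<in> test_functions \<Omega>" and i: "i \<in> Basis"
  note iu = has_weak_gradient_integrable_test[OF \<Omega> u \<psi>] and iv = has_weak_gradient_integrable_test[OF \<Omega> v \<psi>]
  let ?d = "\<lambda>x. frechet_derivative \<psi> (at x) i"
  have "(\<integral>x. (u x - c * v x) * ?d x \<partial>lebesgue_on \<Omega>)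
      = (\<integral>x. u x * ?d x - c * (v x * ?d x) \<partial>lebesgue_on \<Omega>)"
    by (simp add: algebra_simps)
  also have "\<dots> = (\<integral>x. u x * ?d x \<partial>lebesgue_on \<Omega>) - c * (\<integral>x. v x * ?d x \<partial>lebesgue_on \<Omega>)"
    using iu(2)[OF i] iv(2)[OF i] by simp
  also have "\<dots> = - ((\<integral>x. (g x \<bullet> i) * \<psi> x \<partial>lebesgue_on \<Omega>) - c * (\<integral>x. (k x \<bullet> i) * \<psi> x \<partial>lebesgue_on \<Omega>))"
    using u v \<psi> i by (simp add: has_weak_gradient_def)
  also have "\<dots> = - (\<integral>x. (g x \<bullet> i) * \<psi> x - c * ((k x \<bullet> i) * \<psi> x) \<partial>lebesgue_on \<Omega>)"
    using iu(1)[of i] iv(1)[of i] by simp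
  also have "\<dots> = - (\<integral>x. ((g x - c *\<^sub>R k x) \<bullet> i) * \<psi> x \<partial>lebesgue_on \<Omega>)"
    by (simp add: inner_diff_left algebra_simps)
  finally show "(\<integral>x. (u x - c * v x) * ?d x \<partial>lebesgue_on \<Omega>)
      = - (\<integral>x. ((g x - c *\<^sub>R k x) \<bullet> i) * \<psi> x \<partial>lebesgue_on \<Omega>)" .
qed

lemma has_weak_gradient_weak_grad:
  "has_weak_gradient \<Omega> u g \<Longrightarrow> has_weak_gradient \<Omega> u (weak_grad \<Omega> u)"
  unfolding weak_grad_def by (rule someI[of "has_weak_gradient \<Omega> u"])

lemma weak_grad_eq_AE:
  "open \<Omega> \<Longrightarrow> has_weak_gradient \<Omega> u g \<Longrightarrow> AE x in lebesgue_on \<Omega>. weak_grad \<Omega> u x = g x"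
  using has_weak_gradient_unique has_weak_gradient_weak_grad by blast

text \<open>The definition provides integrability on compact subsets only; measurability on \<open>\<Omega>\<close> follows by
  exhausting \<open>\<Omega>\<close> with compact sets.\<close>

lemma has_weak_gradient_measurable:
  assumes \<Omega>: "open \<Omega>" and g: "has_weak_gradient \<Omega> u g"
  shows "g \<in> borel_measurable (lebesgue_on \<Omega>)"
proof -
  obtain C where C: "\<And>n. compact (C n)" "\<And>n. C n \<subseteq> \<Omega>" "\<And>n. C n \<subseteq> interior (C (Suc n))" "(\<Union>n. C n) = \<Omega>"
    using open_Union_compact_subsets[OF \<Omega>] by (metis (no_types, lifting))
  have mono: "C n \<subseteq> C m" if "n \<le> m" for n m
  proof (rule lift_Suc_mono_le[of C, OF _ that])
    show "C n \<subseteq> C (Suc n)" for n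
      using C(3)[of n] interior_subset[of "C (Suc n)"] by blast
  qed
  show ?thesis
  proof (rule borel_measurable_LIMSEQ_metric)
    show "(\<lambda>x. indicator (C n) x *\<^sub>R g x) \<in> borel_measurable (lebesgue_on \<Omega>)" for n
      using has_weak_gradient_integrable(2)[OF g C(1,2)]
      by (intro measurable_restrict_space1) (auto simp: set_integrable_def)
    show "(\<lambda>n. indicator (C n) x *\<^sub>R g x) \<longlonglongrightarrow> g x" if "x \<in> space (lebesgue_on \<Omega>)" for x
    proof (rule tendsto_eventually)
      have "x \<in> (\<Union>n. C n)" using that C(4) by simp
      then obtain n where "x \<in> C n" by blast
      show "\<forall>\<^sub>F n in sequentially. indicator (C n) x *\<^sub>R g x = g x"
        using eventually_ge_at_top[of n]
        by eventually_elim (use mono \<open>x \<in> C n\<close> in \<open>simp add: subset_iff\<close>)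
    qed
  qed
qed

lemma set_integrable_lebesgue_continuous_compact:
  fixes f :: "'a::euclidean_space \<Rightarrow> 'b::euclidean_space"
  assumes "continuous_on UNIV f" "compact K"
  shows "set_integrable lebesgue K f"
proof -
  have "integrable lborel (\<lambda>x. indicator K x *\<^sub>R f x)"
    by (rule borel_integrable_compact[OF assms(2) continuous_on_subset[OF assms(1)]]) simp
  then show ?thesis
    using integrable_completion[OF borel_measurable_integrable] by (auto simp: set_integrable_def)
qed

lemma test_function_has_weak_gradient:
  assumes \<Omega>: "open \<Omega>" and \<psi>: "\<psi> \<in> test_functions \<Omega>"
  shows "has_weak_gradient \<Omega> \<psi> (\<lambda>x. \<Sum>i\<in>Basis. frechet_derivative \<psi> (at x) i *\<^sub>R i)"
    (is "has_weak_gradient \<Omega> \<psi> ?g")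
  unfolding has_weak_gradient_def
proof (intro conjI allI impI ballI)
  fix K assume K: "compact K \<and> K \<subseteq> \<Omega>"
  show "set_integrable lebesgue K \<psi>" "set_integrable lebesgue K ?g"
    using K by (auto intro!: set_integrable_lebesgue_continuous_compact continuous_intros
        test_function_continuous[OF \<psi>] test_function_continuous_partial[OF \<psi>])
next
  fix \<eta> i assume \<eta>: "\<eta> \<in> test_functions \<Omega>" and i: "i \<in> (Basis :: 'a set)"
  have prod: "frechet_derivative (\<lambda>x. \<psi> x * \<eta> x) (at x) i
      = \<psi> x * frechet_derivative \<eta> (at x) i + frechet_derivative \<psi> (at x) i * \<eta> x" for x
    by (subst frechet_derivative_eqI[OF has_derivative_mult[OF test_function_has_derivative[OF \<psi>]
            test_function_has_derivative[OF \<eta>]]]) simp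
  have int: "integrable (lebesgue_on \<Omega>) (\<lambda>x. a x * b x)"
    if "continuous_on UNIV a" "continuous_on UNIV b" "compact K" "K \<subseteq> \<Omega>" "\<And>x. x \<notin> K \<Longrightarrow> b x = 0"
    for a b :: "'a \<Rightarrow> real" and K
    using that by (intro integrable_mult_compact_support[OF \<Omega>] set_integrable_lebesgue_continuous_compact)
  obtain K where K: "compact K" "K \<subseteq> \<Omega>" "\<And>x. x \<notin> K \<Longrightarrow> \<eta> x = 0"
    "\<And>x. x \<notin> K \<Longrightarrow> frechet_derivative \<eta> (at x) = (\<lambda>_. 0)"
    using test_function_support[OF \<eta>] by metis
  have int1: "integrable (lebesgue_on \<Omega>) (\<lambda>x. \<psi> x * frechet_derivative \<eta> (at x) i)"
    by (rule int[OF _ _ K(1,2)])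
       (auto simp: K(4) intro: test_function_continuous[OF \<psi>] test_function_continuous_partial[OF \<eta> i])
  have int2: "integrable (lebesgue_on \<Omega>) (\<lambda>x. frechet_derivative \<psi> (at x) i * \<eta> x)"
    by (rule int[OF _ _ K(1,2)])
       (auto simp: K(3) intro: test_function_continuous[OF \<eta>] test_function_continuous_partial[OF \<psi> i])
  have "(\<integral>x. \<psi> x * frechet_derivative \<eta> (at x) i + frechet_derivative \<psi> (at x) i * \<eta> x \<partial>lebesgue_on \<Omega>) = 0"
    using integral_partial_test_function_zero[OF \<Omega> test_function_mult[OF \<psi> \<eta>] i] by (simp add: prod)
  moreover have "?g x \<bullet> i = frechet_derivative \<psi> (at x) i" for x
    using i by (simp add: inner_sum_left inner_Basis if_distrib[of "\<lambda>c. _ * c"] cong: if_cong)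
  ultimately show "(\<integral>x. \<psi> x * frechet_derivative \<eta> (at x) i \<partial>lebesgue_on \<Omega>)
      = - (\<integral>x. (?g x \<bullet> i) * \<eta> x \<partial>lebesgue_on \<Omega>)"
    using int1 int2 by simp
qed

section \<open>Variable exponent spaces as vector spaces\<close>

lemma powr_add_le:
  fixes a b q P :: real
  assumes "0 \<le> a" "0 \<le> b" "0 \<le> q" "q \<le> P"
  shows "(a + b) powr q \<le> 2 powr P * (a powr q + b powr q)"
proof -
  have "(a + b) powr q \<le> (2 * max a b) powr q"
    using assms by (intro powr_mono2) auto
  also have "\<dots> = 2 powr q * max a b powr q"
    using assms by (simp add: powr_mult)
  also have "\<dots> \<le> 2 powr P * (a powr q + b powr q)"
    using assms by (intro mult_mono powr_mono) (auto simp: max_def)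
  finally show ?thesis .
qed

lemma powr_convex_combination_le:
  fixes x y a b q :: real
  assumes "1 \<le> q" "0 \<le> x" "0 \<le> y" "0 \<le> a" "0 \<le> b" "a + b = 1"
  shows "(a * x + b * y) powr q \<le> a * x powr q + b * y powr q"
proof -
  have scale: "(c * z) powr q \<le> c * z powr q" if "0 \<le> c" "c \<le> 1" "0 \<le> z" for c z
  proof -
    have "c powr q \<le> c"
      using powr_mono'[of 1 q c] that assms(1) by simp
    then show ?thesis using that by (simp add: powr_mult mult_right_mono)
  qed
  consider "x = 0" | "y = 0" | "0 < x" "0 < y" using assms by linarith
  then show ?thesis
  proof cases
    case 3
    moreover have "a = 1 - b" "b \<le> 1" using assms by auto
    ultimately show ?thesis
      using convex_onD[OF powr_convex[OF assms(1)], of b x y] assms(5) by simp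
  qed (use assms scale in auto)
qed

text \<open>A crude substitute for Young's inequality that is uniform in the exponent. It reduces
  integrability of products \<open>w\<^sup>p\<^sup>-\<^sup>1 v\<close> to the fact that \<open>w + v\<close> is in the same space.\<close>

lemma powr_diff_one_mult_le:
  fixes a b q :: real
  assumes "0 \<le> a" "0 \<le> b" "1 \<le> q"
  shows "a powr (q - 1) * b \<le> (a + b) powr q"
proof (cases "a + b = 0")
  case False
  have "a powr (q - 1) * b \<le> (a + b) powr (q - 1) * (a + b)"
    using assms by (intro mult_mono powr_mono2) auto
  also have "\<dots> = (a + b) powr q"
    using False assms powr_add[of "a + b" "q - 1" 1] by simp
  finally show ?thesis .
qed (use assms in \<open>auto simp: add_nonneg_eq_0_iff\<close>)

locale variable_exponent_domain =
  fixes \<Omega> :: "'a::euclidean_space set" and p :: "'a \<Rightarrow> real" and P :: real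
  assumes open_domain: "open \<Omega>" and bounded_domain: "bounded \<Omega>"
    and p_measurable [measurable]: "p \<in> borel_measurable (lebesgue_on \<Omega>)"
    and p_bounds: "\<And>x. x \<in> \<Omega> \<Longrightarrow> 1 < p x" "\<And>x. x \<in> \<Omega> \<Longrightarrow> p x \<le> P"
begin

abbreviation "M \<equiv> lebesgue_on \<Omega>"

lemma finite_measure_domain: "finite_measure M"
  using open_domain bounded_domain by (intro finite_measure_lebesgue_on) (simp add: lmeasurable_open)

lemma AE_domain: "(\<And>x. x \<in> \<Omega> \<Longrightarrow> Q x) \<Longrightarrow> AE x in M. Q x"
  by (rule AE_I2) simp

lemma Lp_measurable: "u \<in> Lp \<Omega> p \<Longrightarrow> u \<in> borel_measurable M"
  by (simp add: Lp_def)

lemma Lp_iff: "u \<in> Lp \<Omega> p \<longleftrightarrow> u \<in> borel_measurable M \<and> integrable M (\<lambda>x. \<bar>u x\<bar> powr p x)"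
  by (auto simp: Lp_def modular_def integrable_iff_bounded)

lemma modular_eq: "u \<in> Lp \<Omega> p \<Longrightarrow> modular \<Omega> p u = ennreal (\<integral>x. \<bar>u x\<bar> powr p x \<partial>M)"
  by (simp add: Lp_iff modular_def nn_integral_eq_integral)

lemma Lp_bound:
  assumes u: "u \<in> Lp \<Omega> p" and v: "v \<in> Lp \<Omega> p"
    and w: "w \<in> borel_measurable M" "AE x in M. \<bar>w x\<bar> \<le> \<bar>u x\<bar> + \<bar>v x\<bar>"
  shows "w \<in> Lp \<Omega> p"
proof -
  note [measurable] = w(1)
  have "integrable M (\<lambda>x. \<bar>w x\<bar> powr p x)"
  proof (rule Bochner_Integration.integrable_bound)
    show "integrable M (\<lambda>x. 2 powr P * (\<bar>u x\<bar> powr p x + \<bar>v x\<bar> powr p x))"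
      using u v by (simp add: Lp_iff)
    show "AE x in M. norm (\<bar>w x\<bar> powr p x) \<le> norm (2 powr P * (\<bar>u x\<bar> powr p x + \<bar>v x\<bar> powr p x))"
      using w(2) AE_space
    proof eventually_elim
      case (elim x)
      then have "\<bar>w x\<bar> powr p x \<le> (\<bar>u x\<bar> + \<bar>v x\<bar>) powr p x"
        using p_bounds(1)[of x] by (intro powr_mono2) auto
      also have "\<dots> \<le> 2 powr P * (\<bar>u x\<bar> powr p x + \<bar>v x\<bar> powr p x)"
        using p_bounds[of x] elim by (intro powr_add_le) auto
      finally show ?case by simp
    qed
  qed measurable
  then show ?thesis using w by (simp add: Lp_iff)
qed

lemma Lp_cmult:
  assumes u: "u \<in> Lp \<Omega> p"
  shows "(\<lambda>x. c * u x) \<in> Lp \<Omega> p"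
proof -
  note [measurable] = Lp_measurable[OF u]
  have "integrable M (\<lambda>x. \<bar>c * u x\<bar> powr p x)"
  proof (rule Bochner_Integration.integrable_bound)
    show "integrable M (\<lambda>x. (1 + \<bar>c\<bar>) powr P * \<bar>u x\<bar> powr p x)"
      using u by (simp add: Lp_iff)
    show "AE x in M. norm (\<bar>c * u x\<bar> powr p x) \<le> norm ((1 + \<bar>c\<bar>) powr P * \<bar>u x\<bar> powr p x)"
    proof (rule AE_domain)
      fix x assume x: "x \<in> \<Omega>"
      have "\<bar>c\<bar> powr p x \<le> (1 + \<bar>c\<bar>) powr p x"
        using p_bounds(1)[OF x] by (intro powr_mono2) auto
      also have "\<dots> \<le> (1 + \<bar>c\<bar>) powr P"
        using p_bounds(2)[OF x] by (intro powr_mono) auto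
      finally show "norm (\<bar>c * u x\<bar> powr p x) \<le> norm ((1 + \<bar>c\<bar>) powr P * \<bar>u x\<bar> powr p x)"
        by (simp add: abs_mult powr_mult mult_right_mono)
    qed
  qed measurable
  then show ?thesis by (simp add: Lp_iff)
qed

lemma Lp_bounded:
  assumes w: "w \<in> borel_measurable M" "AE x in M. \<bar>w x\<bar> \<le> B"
  shows "w \<in> Lp \<Omega> p"
proof -
  have "(\<lambda>_. 1) \<in> Lp \<Omega> p"
    using finite_measure.integrable_const[OF finite_measure_domain, of 1] by (simp add: Lp_iff)
  from Lp_cmult[OF this, of B] have B: "(\<lambda>_. B) \<in> Lp \<Omega> p" by simp
  show ?thesis
    by (rule Lp_bound[OF B B w(1)]) (use w(2) in eventually_elim, auto)
qed

lemma Lp_add_abs: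
  assumes u: "u \<in> Lp \<Omega> p" and v: "v \<in> Lp \<Omega> p"
  shows "(\<lambda>x. \<bar>u x\<bar> + \<bar>v x\<bar>) \<in> Lp \<Omega> p"
  using u v by (intro Lp_bound[OF u v]) (auto simp: Lp_iff)

lemma Lp_diff_cmult:
  assumes u: "u \<in> Lp \<Omega> p" and v: "v \<in> Lp \<Omega> p"
  shows "(\<lambda>x. u x - c * v x) \<in> Lp \<Omega> p"
  using Lp_measurable[OF u] Lp_measurable[OF v]
  by (intro Lp_bound[OF u Lp_cmult[OF v, of c]]) auto

lemma integrable_powr_mult:
  assumes w: "w \<in> Lp \<Omega> p" and v: "v \<in> Lp \<Omega> p"
    and f: "f \<in> borel_measurable M" "AE x in M. \<bar>f x\<bar> \<le> \<bar>w x\<bar> powr (p x - 1) * \<bar>v x\<bar>"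
  shows "integrable M f"
proof (rule Bochner_Integration.integrable_bound)
  show "integrable M (\<lambda>x. \<bar>\<bar>w x\<bar> + \<bar>v x\<bar>\<bar> powr p x)"
    using Lp_add_abs[OF w v] by (simp add: Lp_iff)
  show "AE x in M. norm (f x) \<le> norm (\<bar>\<bar>w x\<bar> + \<bar>v x\<bar>\<bar> powr p x)"
    using f(2) AE_space
  proof eventually_elim
    case (elim x)
    then show ?case
      using powr_diff_one_mult_le[of "\<bar>w x\<bar>" "\<bar>v x\<bar>" "p x"] p_bounds(1)[of x] by simp
  qed
qed (rule f(1))

lemma Lp_integrable:
  assumes v: "v \<in> Lp \<Omega> p"
  shows "integrable M v"
proof -
  have "(\<lambda>_. 1) \<in> Lp \<Omega> p" by (rule Lp_bounded[where B = 1]) auto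
  from integrable_powr_mult[OF this v Lp_measurable[OF v]] show ?thesis by simp
qed

text \<open>This says that the set whose infimum is the Luxemburg norm is nonempty. Without it the infimum
  would be an unspecified real number, and smallness of a norm would carry no information.\<close>

lemma modular_scaled_le_one:
  assumes u: "u \<in> Lp \<Omega> p"
  shows "\<exists>\<tau>>0. modular \<Omega> p (\<lambda>x. u x / \<tau>) \<le> 1"
proof (intro exI conjI)
  \<comment> \<open>As \<open>p \<ge> 1\<close>, division by \<open>\<tau> \<ge> 1\<close> divides the modular by at least \<open>\<tau>\<close>.\<close>
  let ?I = "\<integral>x. \<bar>u x\<bar> powr p x \<partial>M"
  have I: "0 \<le> ?I" by simp
  then show pos: "0 < 1 + ?I" by linarith
  have uI: "(\<lambda>x. u x / (1 + ?I)) \<in> Lp \<Omega> p"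
    using Lp_cmult[OF u, of "1 / (1 + ?I)"] by simp
  have "(\<integral>x. \<bar>u x / (1 + ?I)\<bar> powr p x \<partial>M) \<le> (\<integral>x. \<bar>u x\<bar> powr p x / (1 + ?I) \<partial>M)"
  proof (rule integral_mono_AE)
    show "AE x in M. \<bar>u x / (1 + ?I)\<bar> powr p x \<le> \<bar>u x\<bar> powr p x / (1 + ?I)"
    proof (rule AE_domain)
      fix x assume x: "x \<in> \<Omega>"
      have "(1 + ?I) powr 1 \<le> (1 + ?I) powr p x"
        using p_bounds(1)[OF x] I by (intro powr_mono) auto
      then show "\<bar>u x / (1 + ?I)\<bar> powr p x \<le> \<bar>u x\<bar> powr p x / (1 + ?I)"
        using pos by (simp add: abs_divide powr_divide frac_le)
    qed
  qed (use u uI in \<open>auto simp: Lp_iff\<close>)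
  also have "\<dots> \<le> 1" using pos by simp
  finally show "modular \<Omega> p (\<lambda>x. u x / (1 + ?I)) \<le> 1"
    by (simp add: modular_eq[OF uI] ennreal_le_1)
qed

lemma luxemburg_norm_lessD:
  assumes "u \<in> Lp \<Omega> p" "luxemburg_norm \<Omega> p u < e"
  obtains \<tau> where "0 < \<tau>" "\<tau> < e" "modular \<Omega> p (\<lambda>x. u x / \<tau>) \<le> 1"
proof -
  have "{\<tau>. 0 < \<tau> \<and> modular \<Omega> p (\<lambda>x. u x / \<tau>) \<le> 1} \<noteq> {}"
    using modular_scaled_le_one[OF assms(1)] by blast
  from cInf_lessD[OF this assms(2)[unfolded luxemburg_norm_def]] show thesis
    using that by blast
qed

lemma luxemburg_norm_nonneg: "u \<in> Lp \<Omega> p \<Longrightarrow> 0 \<le> luxemburg_norm \<Omega> p u"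
  unfolding luxemburg_norm_def using modular_scaled_le_one[of u] by (intro cInf_greatest) auto

lemma luxemburg_norm_le:
  assumes "0 < \<tau>" "modular \<Omega> p (\<lambda>x. u x / \<tau>) \<le> 1"
  shows "luxemburg_norm \<Omega> p u \<le> \<tau>"
  unfolding luxemburg_norm_def using assms by (intro cInf_lower bdd_belowI[of _ 0]) auto

text \<open>The triangle inequality of the Luxemburg norm for a function dominated by a combination of \<open>u\<close> and
  \<open>v\<close>: with \<open>s = \<sigma> + \<bar>c\<bar> * \<tau>\<close>, the quotient \<open>w / s\<close> lies below the convex combination of
  \<open>u / \<sigma>\<close> and \<open>v / \<tau>\<close> with weights \<open>\<sigma> / s\<close> and \<open>\<bar>c\<bar> * \<tau> / s\<close>, and powers are convex. The domination is
  only required almost everywhere, since weak gradients are linear only up to null sets.\<close>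

lemma luxemburg_norm_le_combination:
  assumes [measurable]: "u \<in> borel_measurable M" "v \<in> borel_measurable M"
    and \<sigma>: "0 < \<sigma>" "modular \<Omega> p (\<lambda>x. u x / \<sigma>) \<le> 1"
    and \<tau>: "0 < \<tau>" "modular \<Omega> p (\<lambda>x. v x / \<tau>) \<le> 1"
    and w: "AE x in M. \<bar>w x\<bar> \<le> \<bar>u x\<bar> + \<bar>c\<bar> * \<bar>v x\<bar>"
  shows "luxemburg_norm \<Omega> p w \<le> \<sigma> + \<bar>c\<bar> * \<tau>"
proof (rule luxemburg_norm_le)
  let ?s = "\<sigma> + \<bar>c\<bar> * \<tau>"
  show s: "0 < ?s" using \<sigma> \<tau> by (intro add_pos_nonneg) auto
  define \<alpha> \<beta> where "\<alpha> = \<sigma> / ?s" and "\<beta> = \<bar>c\<bar> * \<tau> / ?s"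
  have \<alpha>\<beta>: "0 \<le> \<alpha>" "0 \<le> \<beta>" "\<alpha> + \<beta> = 1"
    using s \<sigma> \<tau> by (auto simp: \<alpha>_def \<beta>_def add_divide_distrib[symmetric])
  have "modular \<Omega> p (\<lambda>x. w x / ?s)
      \<le> (\<integral>\<^sup>+x. ennreal \<alpha> * ennreal (\<bar>u x / \<sigma>\<bar> powr p x) + ennreal \<beta> * ennreal (\<bar>v x / \<tau>\<bar> powr p x) \<partial>M)"
    unfolding modular_def
  proof (rule nn_integral_mono_AE)
    show "AE x in M. ennreal (\<bar>w x / ?s\<bar> powr p x)
        \<le> ennreal \<alpha> * ennreal (\<bar>u x / \<sigma>\<bar> powr p x) + ennreal \<beta> * ennreal (\<bar>v x / \<tau>\<bar> powr p x)"
      using w AE_space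
    proof eventually_elim
      case (elim x)
      then have px: "1 \<le> p x" using p_bounds(1)[of x] by simp
      have "\<bar>w x / ?s\<bar> \<le> (\<bar>u x\<bar> + \<bar>c\<bar> * \<bar>v x\<bar>) / ?s"
        using elim s by (simp add: abs_divide divide_right_mono)
      also have "\<dots> = \<alpha> * \<bar>u x / \<sigma>\<bar> + \<beta> * \<bar>v x / \<tau>\<bar>"
        using \<sigma> \<tau> by (simp add: \<alpha>_def \<beta>_def abs_divide add_divide_distrib)
      finally have "\<bar>w x / ?s\<bar> powr p x \<le> (\<alpha> * \<bar>u x / \<sigma>\<bar> + \<beta> * \<bar>v x / \<tau>\<bar>) powr p x"
        using px by (intro powr_mono2) auto
      also have "\<dots> \<le> \<alpha> * \<bar>u x / \<sigma>\<bar> powr p x + \<beta> * \<bar>v x / \<tau>\<bar> powr p x"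
        using px \<alpha>\<beta> by (intro powr_convex_combination_le) auto
      finally show ?case
        using \<alpha>\<beta> by (simp add: ennreal_mult[symmetric] ennreal_plus[symmetric] del: ennreal_plus)
    qed
  qed
  also have "\<dots> = ennreal \<alpha> * modular \<Omega> p (\<lambda>x. u x / \<sigma>) + ennreal \<beta> * modular \<Omega> p (\<lambda>x. v x / \<tau>)"
    unfolding modular_def by (subst nn_integral_add) (auto simp: nn_integral_cmult)
  also have "\<dots> \<le> ennreal \<alpha> * 1 + ennreal \<beta> * 1"
    using \<sigma> \<tau> by (intro add_mono mult_left_mono) auto
  also have "\<dots> = 1"
    using \<alpha>\<beta> by (simp add: ennreal_plus[symmetric] del: ennreal_plus)
  finally show "modular \<Omega> p (\<lambda>x. w x / ?s) \<le> 1" .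
qed

lemma W1pD:
  assumes "u \<in> W1p \<Omega> p"
  shows "u \<in> Lp \<Omega> p" "has_weak_gradient \<Omega> u (weak_grad \<Omega> u)"
    "(\<lambda>x. norm (weak_grad \<Omega> u x)) \<in> Lp \<Omega> p" "weak_grad \<Omega> u \<in> borel_measurable M"
proof -
  show g: "has_weak_gradient \<Omega> u (weak_grad \<Omega> u)"
    using assms has_weak_gradient_weak_grad by (auto simp: W1p_def)
  show "weak_grad \<Omega> u \<in> borel_measurable M"
    by (rule has_weak_gradient_measurable[OF open_domain g])
qed (use assms in \<open>auto simp: W1p_def\<close>)

lemma W1pI:
  assumes u: "u \<in> Lp \<Omega> p" and g: "has_weak_gradient \<Omega> u g" "(\<lambda>x. norm (g x)) \<in> Lp \<Omega> p"
  shows "u \<in> W1p \<Omega> p"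
proof -
  have "(\<lambda>x. norm (weak_grad \<Omega> u x)) \<in> Lp \<Omega> p"
  proof (rule Lp_bound[OF g(2) g(2)])
    show "(\<lambda>x. norm (weak_grad \<Omega> u x)) \<in> borel_measurable M"
      using has_weak_gradient_measurable[OF open_domain has_weak_gradient_weak_grad[OF g(1)]]
      by measurable
    show "AE x in M. \<bar>norm (weak_grad \<Omega> u x)\<bar> \<le> \<bar>norm (g x)\<bar> + \<bar>norm (g x)\<bar>"
      using weak_grad_eq_AE[OF open_domain g(1)] by eventually_elim simp
  qed
  then show ?thesis using u g(1) by (auto simp: W1p_def)
qed

lemma weak_grad_diff_cmult:
  assumes "u \<in> W1p \<Omega> p" "v \<in> W1p \<Omega> p"
  shows "AE x in M. weak_grad \<Omega> (\<lambda>x. u x - c * v x) x = weak_grad \<Omega> u x - c *\<^sub>R weak_grad \<Omega> v x"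
  using has_weak_gradient_diff_cmult[OF open_domain W1pD(2)[OF assms(1)] W1pD(2)[OF assms(2)]]
  by (rule weak_grad_eq_AE[OF open_domain])

lemma W1p_diff_cmult:
  assumes u: "u \<in> W1p \<Omega> p" and v: "v \<in> W1p \<Omega> p"
  shows "(\<lambda>x. u x - c * v x) \<in> W1p \<Omega> p"
proof (rule W1pI)
  show "(\<lambda>x. u x - c * v x) \<in> Lp \<Omega> p"
    by (rule Lp_diff_cmult[OF W1pD(1)[OF u] W1pD(1)[OF v]])
  show "has_weak_gradient \<Omega> (\<lambda>x. u x - c * v x) (\<lambda>x. weak_grad \<Omega> u x - c *\<^sub>R weak_grad \<Omega> v x)"
    by (rule has_weak_gradient_diff_cmult[OF open_domain W1pD(2)[OF u] W1pD(2)[OF v]])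
  show "(\<lambda>x. norm (weak_grad \<Omega> u x - c *\<^sub>R weak_grad \<Omega> v x)) \<in> Lp \<Omega> p"
  proof (rule Lp_bound[OF W1pD(3)[OF u] Lp_cmult[OF W1pD(3)[OF v], of c]])
    show "(\<lambda>x. norm (weak_grad \<Omega> u x - c *\<^sub>R weak_grad \<Omega> v x)) \<in> borel_measurable M"
      using W1pD(4)[OF u] W1pD(4)[OF v] by measurable
    show "AE x in M. \<bar>norm (weak_grad \<Omega> u x - c *\<^sub>R weak_grad \<Omega> v x)\<bar>
        \<le> \<bar>norm (weak_grad \<Omega> u x)\<bar> + \<bar>c * norm (weak_grad \<Omega> v x)\<bar>"
      using norm_triangle_ineq4[of "weak_grad \<Omega> u _" "c *\<^sub>R weak_grad \<Omega> v _"]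
      by (auto simp: abs_mult)
  qed
qed

text \<open>By integration by parts the classical gradient of a test function is its weak gradient. Hence
  \<open>u - \<psi>\<close> is a Sobolev function in the definition of \<open>W01p\<close>, and its norm there is a genuine one.\<close>

lemma test_functions_subset_W1p: "test_functions \<Omega> \<subseteq> W1p \<Omega> p"
proof
  fix \<psi> assume \<psi>: "\<psi> \<in> test_functions \<Omega>"
  let ?g = "\<lambda>x. \<Sum>i\<in>Basis. frechet_derivative \<psi> (at x) i *\<^sub>R i"
  obtain K where K: "compact K" "K \<subseteq> \<Omega>" "\<And>x. x \<notin> K \<Longrightarrow> \<psi> x = 0"
    "\<And>x. x \<notin> K \<Longrightarrow> frechet_derivative \<psi> (at x) = (\<lambda>_. 0)"
    using test_function_support[OF \<psi>] by metis
  have bounded: "f \<in> Lp \<Omega> p" if f: "continuous_on UNIV f" "\<And>x. x \<notin> K \<Longrightarrow> f x = 0" for f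
  proof -
    obtain B where "\<And>x. \<bar>f x\<bar> \<le> B"
      using continuous_compact_support_bounded[OF f(1) K(1) f(2)] by metis
    then show ?thesis
      using borel_measurable_lebesgue_on_continuous[OF f(1)] by (intro Lp_bounded) auto
  qed
  show "\<psi> \<in> W1p \<Omega> p"
  proof (rule W1pI)
    show "\<psi> \<in> Lp \<Omega> p"
      by (rule bounded[OF test_function_continuous[OF \<psi>] K(3)])
    show "has_weak_gradient \<Omega> \<psi> ?g"
      by (rule test_function_has_weak_gradient[OF open_domain \<psi>])
    show "(\<lambda>x. norm (?g x)) \<in> Lp \<Omega> p"
      by (rule bounded) (auto simp: K(4) intro!: continuous_intros test_function_continuous_partial[OF \<psi>])
  qed
qed

lemma W01p_W1p: "u \<in> W01p \<Omega> p \<Longrightarrow> u \<in> W1p \<Omega> p"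
  by (simp add: W01p_def)

text \<open>If test functions \<open>\<psi>\<close> and \<open>\<eta>\<close> approximate \<open>u\<close> and \<open>v\<close>, then \<open>\<psi> - c \<eta>\<close> approximates \<open>u - c v\<close>.
  Closure under \<open>u - c v\<close> is the vector space property that is needed: it provides both
  the variations \<open>u + t \<phi>\<close> and the projection of a direction onto the tangent space.\<close>

lemma W01p_diff_cmult:
  assumes u: "u \<in> W01p \<Omega> p" and v: "v \<in> W01p \<Omega> p"
  shows "(\<lambda>x. u x - c * v x) \<in> W01p \<Omega> p"
  unfolding W01p_def
proof (intro CollectI conjI allI impI)
  show "(\<lambda>x. u x - c * v x) \<in> W1p \<Omega> p"
    using u v by (intro W1p_diff_cmult W01p_W1p)
  fix e :: real assume e: "0 < e"
  define d where "d = e / (4 * (1 + \<bar>c\<bar>))"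
  have d: "0 < d" using e by (simp add: d_def add_pos_nonneg)
  have approx: "\<exists>\<psi>\<in>test_functions \<Omega>. (\<lambda>x. w x - \<psi> x) \<in> W1p \<Omega> p \<and>
      (\<exists>\<sigma> \<tau>. 0 < \<sigma> \<and> \<sigma> < d \<and> modular \<Omega> p (\<lambda>x. (w x - \<psi> x) / \<sigma>) \<le> 1 \<and>
        0 < \<tau> \<and> \<tau> < d \<and> modular \<Omega> p (\<lambda>x. norm (weak_grad \<Omega> (\<lambda>x. w x - \<psi> x) x) / \<tau>) \<le> 1)"
    if w: "w \<in> W01p \<Omega> p" for w
  proof -
    obtain \<psi> where \<psi>: "\<psi> \<in> test_functions \<Omega>" "W1p_norm \<Omega> p (\<lambda>x. w x - \<psi> x) < d"
      using w d by (auto simp: W01p_def)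
    have W: "(\<lambda>x. w x - \<psi> x) \<in> W1p \<Omega> p"
      using W1p_diff_cmult[OF W01p_W1p[OF w], of \<psi> 1] \<psi>(1) test_functions_subset_W1p by auto
    note L = W1pD(1)[OF W] W1pD(3)[OF W]
    have less: "luxemburg_norm \<Omega> p (\<lambda>x. w x - \<psi> x) < d"
      "luxemburg_norm \<Omega> p (\<lambda>x. norm (weak_grad \<Omega> (\<lambda>x. w x - \<psi> x) x)) < d"
      using \<psi>(2) luxemburg_norm_nonneg[OF L(1)] luxemburg_norm_nonneg[OF L(2)]
      unfolding W1p_norm_def by linarith+
    obtain \<sigma> where "0 < \<sigma>" "\<sigma> < d" "modular \<Omega> p (\<lambda>x. (w x - \<psi> x) / \<sigma>) \<le> 1"
      using luxemburg_norm_lessD[OF L(1) less(1)] by blast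
    moreover obtain \<tau> where "0 < \<tau>" "\<tau> < d"
      "modular \<Omega> p (\<lambda>x. norm (weak_grad \<Omega> (\<lambda>x. w x - \<psi> x) x) / \<tau>) \<le> 1"
      using luxemburg_norm_lessD[OF L(2) less(2)] by blast
    ultimately show ?thesis using \<psi>(1) W by blast
  qed
  obtain \<psi> \<sigma>1 \<sigma>2 where \<psi>: "\<psi> \<in> test_functions \<Omega>" and u\<psi>: "(\<lambda>x. u x - \<psi> x) \<in> W1p \<Omega> p"
    and \<sigma>: "0 < \<sigma>1" "\<sigma>1 < d" "modular \<Omega> p (\<lambda>x. (u x - \<psi> x) / \<sigma>1) \<le> 1"
      "0 < \<sigma>2" "\<sigma>2 < d" "modular \<Omega> p (\<lambda>x. norm (weak_grad \<Omega> (\<lambda>x. u x - \<psi> x) x) / \<sigma>2) \<le> 1"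
    using approx[OF u] by blast
  obtain \<eta> \<tau>1 \<tau>2 where \<eta>: "\<eta> \<in> test_functions \<Omega>" and v\<eta>: "(\<lambda>x. v x - \<eta> x) \<in> W1p \<Omega> p"
    and \<tau>: "0 < \<tau>1" "\<tau>1 < d" "modular \<Omega> p (\<lambda>x. (v x - \<eta> x) / \<tau>1) \<le> 1"
      "0 < \<tau>2" "\<tau>2 < d" "modular \<Omega> p (\<lambda>x. norm (weak_grad \<Omega> (\<lambda>x. v x - \<eta> x) x) / \<tau>2) \<le> 1"
    using approx[OF v] by blast
  let ?w = "\<lambda>x. (u x - c * v x) - (\<psi> x - c * \<eta> x)"
  have w: "?w = (\<lambda>x. (u x - \<psi> x) - c * (v x - \<eta> x))"
    by (simp add: algebra_simps)
  have "luxemburg_norm \<Omega> p ?w \<le> \<sigma>1 + \<bar>c\<bar> * \<tau>1"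
  proof (rule luxemburg_norm_le_combination[OF _ _ \<sigma>(1,3) \<tau>(1,3)])
    show "AE x in M. \<bar>?w x\<bar> \<le> \<bar>u x - \<psi> x\<bar> + \<bar>c\<bar> * \<bar>v x - \<eta> x\<bar>"
      using abs_triangle_ineq4[of "u _ - \<psi> _" "c * (v _ - \<eta> _)"]
      by (intro always_eventually allI) (simp add: fun_cong[OF w] abs_mult)
  qed (use W1pD(1)[OF u\<psi>] W1pD(1)[OF v\<eta>] in \<open>auto dest: Lp_measurable\<close>)
  moreover have "luxemburg_norm \<Omega> p (\<lambda>x. norm (weak_grad \<Omega> ?w x)) \<le> \<sigma>2 + \<bar>c\<bar> * \<tau>2"
  proof (rule luxemburg_norm_le_combination[OF _ _ \<sigma>(4,6) \<tau>(4,6)])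
    show "AE x in M. \<bar>norm (weak_grad \<Omega> ?w x)\<bar>
        \<le> \<bar>norm (weak_grad \<Omega> (\<lambda>x. u x - \<psi> x) x)\<bar> + \<bar>c\<bar> * \<bar>norm (weak_grad \<Omega> (\<lambda>x. v x - \<eta> x) x)\<bar>"
      unfolding w using weak_grad_diff_cmult[OF u\<psi> v\<eta>, of c]
    proof eventually_elim
      case (elim x)
      show ?case
        unfolding elim
        using norm_triangle_ineq4[of "weak_grad \<Omega> (\<lambda>x. u x - \<psi> x) x" "c *\<^sub>R weak_grad \<Omega> (\<lambda>x. v x - \<eta> x) x"]
        by simp
    qed
  qed (use W1pD(3)[OF u\<psi>] W1pD(3)[OF v\<eta>] in \<open>auto dest: Lp_measurable\<close>)
  ultimately have "W1p_norm \<Omega> p ?w \<le> (\<sigma>1 + \<bar>c\<bar> * \<tau>1) + (\<sigma>2 + \<bar>c\<bar> * \<tau>2)"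
    unfolding W1p_norm_def by linarith
  also have "\<dots> \<le> (d + \<bar>c\<bar> * d) + (d + \<bar>c\<bar> * d)"
    using \<sigma> \<tau> by (intro add_mono mult_left_mono) auto
  also have "\<dots> = 2 * (1 + \<bar>c\<bar>) * d" by (simp add: algebra_simps)
  also have "\<dots> = e / 2" by (simp add: d_def field_simps add_pos_nonneg) 
  also have "\<dots> < e" using e by simp
  finally have "W1p_norm \<Omega> p ?w < e" .
  then show "\<exists>\<psi>\<in>test_functions \<Omega>. W1p_norm \<Omega> p (\<lambda>x. u x - c * v x - \<psi> x) < e"
    using test_function_diff_cmult[OF \<psi> \<eta>, of c] by (intro bexI[of _ "\<lambda>x. \<psi> x - c * \<eta> x"]) auto
qed

end

section \<open>Derivatives of the functionals along lines\<close>

lemma r_eps_pos: "0 < \<epsilon> \<Longrightarrow> 0 < r_eps \<epsilon> \<xi>"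
  by (simp add: r_eps_def add_pos_nonneg)

lemma r_eps_le: "0 < \<epsilon> \<Longrightarrow> r_eps \<epsilon> \<xi> \<le> \<epsilon> + norm \<xi>"
  unfolding r_eps_def using sqrt_sum_squares_le_sum[of \<epsilon> "norm \<xi>"] by simp

lemma norm_le_r_eps: "norm \<xi> \<le> r_eps \<epsilon> \<xi>"
  unfolding r_eps_def by (rule real_le_rsqrt) simp

lemma r_eps_measurable [measurable]:
  "f \<in> borel_measurable N \<Longrightarrow> (\<lambda>x. r_eps \<epsilon> (f x)) \<in> borel_measurable N"
  unfolding r_eps_def by measurable

lemma norm_A_eps_le:
  assumes "0 < \<epsilon>"
  shows "norm (A_eps \<epsilon> p x \<xi>) \<le> r_eps \<epsilon> \<xi> powr (p x - 1)"
proof -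
  note r = r_eps_pos[OF assms, of \<xi>]
  have "norm (A_eps \<epsilon> p x \<xi>) \<le> r_eps \<epsilon> \<xi> powr (p x - 2) * r_eps \<epsilon> \<xi>"
    unfolding A_eps_def using norm_le_r_eps[of \<xi> \<epsilon>] by (simp add: mult_left_mono)
  also have "\<dots> = r_eps \<epsilon> \<xi> powr (p x - 1)"
    using r powr_add[of "r_eps \<epsilon> \<xi>" "p x - 2" 1] by simp
  finally show ?thesis .
qed

lemma DERIV_Phi_eps_line:
  assumes "0 < \<epsilon>" "p x \<noteq> 0"
  shows "((\<lambda>t. Phi_eps \<epsilon> p x (\<xi> + t *\<^sub>R \<zeta>)) has_real_derivative
    A_eps \<epsilon> p x (\<xi> + s *\<^sub>R \<zeta>) \<bullet> \<zeta>) (at s)"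
proof -
  let ?\<xi> = "\<xi> + s *\<^sub>R \<zeta>"
  let ?r = "\<lambda>t. r_eps \<epsilon> (\<xi> + t *\<^sub>R \<zeta>)"
  note r = r_eps_pos[OF assms(1), of ?\<xi>]
  define q where "q t = \<epsilon>\<^sup>2 + (\<xi> + t *\<^sub>R \<zeta>) \<bullet> (\<xi> + t *\<^sub>R \<zeta>)" for t
  have q_r: "?r t = sqrt (q t)" for t
    by (simp add: r_eps_def q_def power2_norm_eq_inner)
  have q_pos: "0 < q s"
    unfolding q_def using assms(1) by (intro add_pos_nonneg) auto
  have "(q has_real_derivative 2 * (?\<xi> \<bullet> \<zeta>)) (at s)"
    unfolding has_field_derivative_def q_def[abs_def]
    by (auto intro!: derivative_eq_intros simp: inner_commute algebra_simps fun_eq_iff)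
  then have "((\<lambda>t. sqrt (q t)) has_real_derivative inverse (sqrt (q s)) / 2 * (2 * (?\<xi> \<bullet> \<zeta>))) (at s)"
    by (rule DERIV_chain2[of sqrt _ q, OF DERIV_real_sqrt[OF q_pos]])
  moreover have "inverse (sqrt (q s)) / 2 * (2 * (?\<xi> \<bullet> \<zeta>)) = (?\<xi> \<bullet> \<zeta>) / sqrt (q s)"
    by (simp add: field_simps)
  ultimately have dr: "(?r has_real_derivative (?\<xi> \<bullet> \<zeta>) / ?r s) (at s)"
    by (simp only: q_r)
  have "((\<lambda>t. ?r t powr p x) has_real_derivative
      p x * ?r s powr (p x - 1) * ((?\<xi> \<bullet> \<zeta>) / ?r s)) (at s)"
    by (rule DERIV_chain2[of "\<lambda>z. z powr p x" _ ?r, OF has_real_derivative_powr[OF r] dr])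
  then have "((\<lambda>t. (?r t powr p x - \<epsilon> powr p x) / p x) has_real_derivative
      (p x * ?r s powr (p x - 1) * ((?\<xi> \<bullet> \<zeta>) / ?r s) - 0) / p x) (at s)"
    by (intro DERIV_cdivide DERIV_diff DERIV_const)
  moreover have "?r s powr (p x - 1) / ?r s = ?r s powr (p x - 2)"
    using r powr_diff[of "?r s" "p x - 1" 1] by simp
  moreover have "(p x * ?r s powr (p x - 1) * ((?\<xi> \<bullet> \<zeta>) / ?r s) - 0) / p x
      = ?r s powr (p x - 1) / ?r s * (?\<xi> \<bullet> \<zeta>)"
    using assms(2) by simp
  ultimately show ?thesis
    by (simp only: Phi_eps_def A_eps_def inner_scaleR_left)
qed

text \<open>At \<open>s = 0\<close> the one-sided derivatives of the formula and of its tangent line continuation agree,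
  so that no case distinction in the sign of the variation arises where \<open>u\<close> vanishes.\<close>

lemma DERIV_G_delta:
  assumes "0 < \<delta>" "\<gamma> x < 1"
  shows "(G_delta \<delta> \<gamma> x has_real_derivative
    (if 0 \<le> s then (s + \<delta>) powr (- \<gamma> x) else \<delta> powr (- \<gamma> x))) (at s)"
proof -
  let ?F = "\<lambda>s. ((s + \<delta>) powr (1 - \<gamma> x) - \<delta> powr (1 - \<gamma> x)) / (1 - \<gamma> x)"
  let ?L = "\<lambda>s. \<delta> powr (- \<gamma> x) * s"
  have F: "(?F has_real_derivative (s + \<delta>) powr (- \<gamma> x)) (at s)" if "0 \<le> s" for s
  proof -
    have "((\<lambda>s. (s + \<delta>) powr (1 - \<gamma> x)) has_real_derivative
        (1 - \<gamma> x) * (s + \<delta>) powr (1 - \<gamma> x - 1) * 1) (at s)"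
      using that assms by (intro DERIV_chain2[OF has_real_derivative_powr])
        (auto intro!: derivative_eq_intros)
    then have "(?F has_real_derivative
        ((1 - \<gamma> x) * (s + \<delta>) powr (1 - \<gamma> x - 1) * 1 - 0) / (1 - \<gamma> x)) (at s)"
      by (intro DERIV_cdivide DERIV_diff DERIV_const)
    then show ?thesis using assms by simp
  qed
  have L: "(?L has_real_derivative \<delta> powr (- \<gamma> x)) (at s)" for s
    by (auto intro!: derivative_eq_intros)
  consider "0 < s" | "s = 0" | "s < 0" by linarith
  then show ?thesis
  proof cases
    case 1
    have "(G_delta \<delta> \<gamma> x has_real_derivative (s + \<delta>) powr (- \<gamma> x)) (at s)"
      by (rule has_field_derivative_transform_within_open[OF F, of s "{0<..}"])
         (use 1 in \<open>auto simp: G_delta_def\<close>)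
    then show ?thesis using 1 by simp
  next
    case 3
    have "(G_delta \<delta> \<gamma> x has_real_derivative \<delta> powr (- \<gamma> x)) (at s)"
      by (rule has_field_derivative_transform_within_open[OF L, of "{..<0}"])
         (use 3 in \<open>auto simp: G_delta_def\<close>)
    then show ?thesis using 3 by simp
  next
    case 2
    have G0: "G_delta \<delta> \<gamma> x 0 = 0" by (simp add: G_delta_def)
    have "((\<lambda>s. (?F s - ?F 0) / (s - 0)) \<longlongrightarrow> \<delta> powr (- \<gamma> x)) (at_right 0)"
      using F[of 0] unfolding has_field_derivative_iff filterlim_at_split by simp
    then have "((\<lambda>s. G_delta \<delta> \<gamma> x s / s) \<longlongrightarrow> \<delta> powr (- \<gamma> x)) (at_right 0)"
      by (rule Lim_transform_eventually) (auto simp: eventually_at_filter G_delta_def)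
    moreover have "((\<lambda>s. G_delta \<delta> \<gamma> x s / s) \<longlongrightarrow> \<delta> powr (- \<gamma> x)) (at_left 0)"
      by (rule tendsto_eventually) (auto simp: eventually_at_filter G_delta_def)
    ultimately have "((\<lambda>s. G_delta \<delta> \<gamma> x s / s) \<longlongrightarrow> \<delta> powr (- \<gamma> x)) (at 0)"
      by (simp add: filterlim_at_split)
    then show ?thesis using 2 by (simp add: has_field_derivative_iff G0)
  qed
qed

text \<open>Here the regularisation \<open>\<delta> > 0\<close> tames the singularity: the slope is at most \<open>\<delta> powr - \<gamma> x\<close>, and
  \<open>1 / \<delta>\<close> bounds this uniformly in \<open>x\<close> because \<open>\<gamma> x < 1\<close> and \<open>\<delta> \<le> 1\<close>.\<close>

lemma G_delta_lipschitz:
  assumes "0 < \<delta>" "\<delta> \<le> 1" "0 < \<gamma> x" "\<gamma> x < 1"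
  shows "\<bar>G_delta \<delta> \<gamma> x s - G_delta \<delta> \<gamma> x t\<bar> \<le> \<bar>s - t\<bar> / \<delta>"
proof -
  have d: "\<delta> powr (- \<gamma> x) \<le> 1 / \<delta>"
    using powr_mono'[of "- 1" "- \<gamma> x" \<delta>] assms by (simp add: powr_minus_divide)
  have "norm (G_delta \<delta> \<gamma> x s - G_delta \<delta> \<gamma> x t) \<le> 1 / \<delta> * norm (s - t)"
  proof (rule field_differentiable_bound[of UNIV])
    show "(G_delta \<delta> \<gamma> x has_field_derivative
        (if 0 \<le> z then (z + \<delta>) powr (- \<gamma> x) else \<delta> powr (- \<gamma> x))) (at z within UNIV)" for z
      using DERIV_G_delta[of \<delta> \<gamma> x z] assms by simp
    show "norm (if 0 \<le> z then (z + \<delta>) powr (- \<gamma> x) else \<delta> powr (- \<gamma> x)) \<le> 1 / \<delta>" for z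
      using d powr_mono2'[of "- \<gamma> x" \<delta> "z + \<delta>"] assms by auto
  qed auto
  then show ?thesis by simp
qed

lemma G_delta_measurable:
  assumes [measurable]: "\<gamma> \<in> borel_measurable N" "u \<in> borel_measurable N"
  shows "(\<lambda>x. G_delta \<delta> \<gamma> x (u x)) \<in> borel_measurable N"
  unfolding G_delta_def by measurable

context variable_exponent_domain
begin

lemma gradient_term_integrable:
  assumes \<epsilon>: "0 < \<epsilon>" and u: "u \<in> W1p \<Omega> p" and \<phi>: "\<phi> \<in> W1p \<Omega> p"
  shows "integrable M (\<lambda>x. A_eps \<epsilon> p x (weak_grad \<Omega> u x) \<bullet> weak_grad \<Omega> \<phi> x)"
proof (rule integrable_powr_mult[OF _ W1pD(3)[OF \<phi>]])
  note [measurable] = W1pD(4)[OF u] W1pD(4)[OF \<phi>]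
  show "(\<lambda>x. r_eps \<epsilon> (weak_grad \<Omega> u x)) \<in> Lp \<Omega> p"
  proof (rule Lp_bound[OF Lp_bounded[of "\<lambda>_. \<epsilon>"] W1pD(3)[OF u]])
    show "AE x in M. \<bar>r_eps \<epsilon> (weak_grad \<Omega> u x)\<bar> \<le> \<bar>\<epsilon>\<bar> + \<bar>norm (weak_grad \<Omega> u x)\<bar>"
      using \<epsilon> by (intro always_eventually allI) (simp add: abs_of_pos[OF r_eps_pos[OF \<epsilon>]] r_eps_le)
  qed auto
  show "(\<lambda>x. A_eps \<epsilon> p x (weak_grad \<Omega> u x) \<bullet> weak_grad \<Omega> \<phi> x) \<in> borel_measurable M"
    unfolding A_eps_def by measurable
  show "AE x in M. \<bar>A_eps \<epsilon> p x (weak_grad \<Omega> u x) \<bullet> weak_grad \<Omega> \<phi> x\<bar>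
      \<le> \<bar>r_eps \<epsilon> (weak_grad \<Omega> u x)\<bar> powr (p x - 1) * \<bar>norm (weak_grad \<Omega> \<phi> x)\<bar>"
  proof (rule AE_domain)
    fix x
    have "\<bar>A_eps \<epsilon> p x (weak_grad \<Omega> u x) \<bullet> weak_grad \<Omega> \<phi> x\<bar>
        \<le> norm (A_eps \<epsilon> p x (weak_grad \<Omega> u x)) * norm (weak_grad \<Omega> \<phi> x)"
      by (rule Cauchy_Schwarz_ineq2)
    also have "\<dots> \<le> r_eps \<epsilon> (weak_grad \<Omega> u x) powr (p x - 1) * norm (weak_grad \<Omega> \<phi> x)"
      by (intro mult_right_mono norm_A_eps_le \<epsilon>) auto
    finally show "\<bar>A_eps \<epsilon> p x (weak_grad \<Omega> u x) \<bullet> weak_grad \<Omega> \<phi> x\<bar>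
        \<le> \<bar>r_eps \<epsilon> (weak_grad \<Omega> u x)\<bar> powr (p x - 1) * \<bar>norm (weak_grad \<Omega> \<phi> x)\<bar>"
      by (simp add: abs_of_pos[OF r_eps_pos[OF \<epsilon>]])
  qed
qed

lemma power_term_integrable:
  assumes u: "u \<in> Lp \<Omega> p" "AE x in M. 0 \<le> u x" and \<phi>: "\<phi> \<in> Lp \<Omega> p"
  shows "integrable M (\<lambda>x. u x powr (p x - 1) * \<phi> x)"
proof (rule integrable_powr_mult[OF u(1) \<phi>])
  note [measurable] = Lp_measurable[OF u(1)] Lp_measurable[OF \<phi>]
  show "(\<lambda>x. u x powr (p x - 1) * \<phi> x) \<in> borel_measurable M" by measurable
  show "AE x in M. \<bar>u x powr (p x - 1) * \<phi> x\<bar> \<le> \<bar>u x\<bar> powr (p x - 1) * \<bar>\<phi> x\<bar>"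
    using u(2) by eventually_elim (simp add: abs_mult)
qed

text \<open>Along the line, the integrand has derivative \<open>A_eps \<bullet> \<nabla>\<phi>\<close>, and \<open>\<bar>A_eps\<bar> \<le> r_eps\<^sup>p\<^sup>-\<^sup>1\<close>. For \<open>\<bar>t\<bar> \<le> 1\<close> the
  quantity \<open>r_eps\<close> stays below \<open>W = \<epsilon> + \<bar>\<nabla>u\<bar> + \<bar>\<nabla>\<phi>\<bar>\<close>, so \<open>W\<^sup>p\<^sup>-\<^sup>1 \<bar>\<nabla>\<phi>\<bar>\<close> is an integrable Lipschitz bound.\<close>

lemma E_eps_has_derivative:
  assumes \<epsilon>: "0 < \<epsilon>" and u: "u \<in> W1p \<Omega> p" and \<phi>: "\<phi> \<in> W1p \<Omega> p"
  shows "((\<lambda>t. E_eps \<Omega> p \<epsilon> (\<lambda>x. u x + t * \<phi> x)) has_real_derivative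
    (\<integral>x. A_eps \<epsilon> p x (weak_grad \<Omega> u x) \<bullet> weak_grad \<Omega> \<phi> x \<partial>M)) (at 0)"
proof -
  let ?\<xi> = "weak_grad \<Omega> u" and ?\<zeta> = "weak_grad \<Omega> \<phi>"
  note [measurable] = W1pD(4)[OF u] W1pD(4)[OF \<phi>]
  define f where "f t x = Phi_eps \<epsilon> p x (?\<xi> x + t *\<^sub>R ?\<zeta> x)" for t x
  define W where "W t x = \<bar>\<epsilon>\<bar> + \<bar>\<bar>norm (?\<xi> x)\<bar> + \<bar>t * norm (?\<zeta> x)\<bar>\<bar>" for t x
  have f_m [measurable]: "f t \<in> borel_measurable M" for t
    unfolding f_def Phi_eps_def by measurable
  have W: "W t \<in> Lp \<Omega> p" for t
    unfolding W_def
    by (intro Lp_add_abs Lp_bounded[of "\<lambda>_. \<epsilon>" "\<bar>\<epsilon>\<bar>"] Lp_cmult W1pD(3) u \<phi>) auto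
  have rW: "r_eps \<epsilon> (?\<xi> x + s *\<^sub>R ?\<zeta> x) \<le> W t x" if "\<bar>s\<bar> \<le> \<bar>t\<bar>" for s t x
  proof -
    have "norm (s *\<^sub>R ?\<zeta> x) \<le> \<bar>t\<bar> * norm (?\<zeta> x)"
      using that by (simp add: mult_right_mono)
    then show ?thesis
      using r_eps_le[OF \<epsilon>, of "?\<xi> x + s *\<^sub>R ?\<zeta> x"] norm_triangle_ineq[of "?\<xi> x" "s *\<^sub>R ?\<zeta> x"] \<epsilon>
      by (simp add: W_def abs_mult)
  qed
  have W_nonneg: "0 \<le> W t x" for t x by (simp add: W_def)
  have "E_eps \<Omega> p \<epsilon> (\<lambda>x. u x + t * \<phi> x) = (\<integral>x. f t x \<partial>M)" for t
    unfolding E_eps_def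
  proof (rule integral_cong_AE)
    have "(\<lambda>x. u x + t * \<phi> x) \<in> W1p \<Omega> p"
      using W1p_diff_cmult[OF u \<phi>, of "- t"] by simp
    note [measurable] = W1pD(4)[OF this]
    show "(\<lambda>x. Phi_eps \<epsilon> p x (weak_grad \<Omega> (\<lambda>x. u x + t * \<phi> x) x)) \<in> borel_measurable M"
      unfolding Phi_eps_def by measurable
    show "AE x in M. Phi_eps \<epsilon> p x (weak_grad \<Omega> (\<lambda>x. u x + t * \<phi> x) x) = f t x"
      using weak_grad_diff_cmult[OF u \<phi>, of "- t"] by eventually_elim (simp add: f_def)
  qed (rule f_m)
  moreover have "((\<lambda>t. \<integral>x. f t x \<partial>M) has_real_derivative
    (\<integral>x. A_eps \<epsilon> p x (?\<xi> x) \<bullet> ?\<zeta> x \<partial>M)) (at 0)"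
  proof (rule has_derivative_integral_dominated)
    show "integrable M (f t)" for t
    proof (rule Bochner_Integration.integrable_bound)
      show "integrable M (\<lambda>x. \<bar>W t x\<bar> powr p x)" using W by (simp add: Lp_iff)
      show "AE x in M. norm (f t x) \<le> norm (\<bar>W t x\<bar> powr p x)"
      proof (rule AE_domain)
        fix x assume x: "x \<in> \<Omega>"
        let ?r = "r_eps \<epsilon> (?\<xi> x + t *\<^sub>R ?\<zeta> x)"
        have "\<epsilon> \<le> ?r"
          unfolding r_eps_def by (rule real_le_rsqrt) simp
        then have "\<epsilon> powr p x \<le> ?r powr p x"
          using \<epsilon> p_bounds(1)[OF x] by (intro powr_mono2) auto
        then have "norm (f t x) = (?r powr p x - \<epsilon> powr p x) / p x"
          using p_bounds(1)[OF x] by (simp add: f_def Phi_eps_def)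
        also have "\<dots> \<le> ?r powr p x"
        proof -
          have "?r powr p x * 1 \<le> ?r powr p x * p x"
            using p_bounds(1)[OF x] by (intro mult_left_mono) auto
          then have "?r powr p x - \<epsilon> powr p x \<le> ?r powr p x * p x"
            using powr_ge_zero[of \<epsilon> "p x"] by linarith
          then show ?thesis using p_bounds(1)[OF x] by (simp add: pos_divide_le_eq)
        qed
        also have "\<dots> \<le> W t x powr p x"
          using rW[of t t x] r_eps_pos[OF \<epsilon>, of "?\<xi> x + t *\<^sub>R ?\<zeta> x"] p_bounds(1)[OF x]
          by (intro powr_mono2) auto
        finally show "norm (f t x) \<le> norm (\<bar>W t x\<bar> powr p x)"
          using W_nonneg by simp
      qed
    qed (rule f_m)
    show "(\<lambda>x. A_eps \<epsilon> p x (?\<xi> x) \<bullet> ?\<zeta> x) \<in> borel_measurable M"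
      unfolding A_eps_def by measurable
    show "integrable M (\<lambda>x. W 1 x powr (p x - 1) * norm (?\<zeta> x))"
      using Lp_measurable[OF W[of 1]] W_nonneg
      by (intro integrable_powr_mult[OF W[of 1] W1pD(3)[OF \<phi>]]) auto
    show "AE x in M. ((\<lambda>t. f t x) has_real_derivative A_eps \<epsilon> p x (?\<xi> x) \<bullet> ?\<zeta> x) (at 0)"
    proof (rule AE_domain)
      fix x assume "x \<in> \<Omega>"
      then show "((\<lambda>t. f t x) has_real_derivative A_eps \<epsilon> p x (?\<xi> x) \<bullet> ?\<zeta> x) (at 0)"
        using DERIV_Phi_eps_line[OF \<epsilon>, of p x "?\<xi> x" "?\<zeta> x" 0] p_bounds(1)[of x] by (simp add: f_def)
    qed
    show "AE x in M. \<bar>f t x - f 0 x\<bar> \<le> \<bar>t\<bar> * (W 1 x powr (p x - 1) * norm (?\<zeta> x))"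
      if t: "\<bar>t\<bar> \<le> 1" for t
    proof (rule AE_domain)
      fix x assume x: "x \<in> \<Omega>"
      have "norm (f t x - f 0 x) \<le> W 1 x powr (p x - 1) * norm (?\<zeta> x) * norm (t - 0)"
      proof (rule field_differentiable_bound[of "{-1..1}"])
        show "((\<lambda>t. f t x) has_field_derivative A_eps \<epsilon> p x (?\<xi> x + s *\<^sub>R ?\<zeta> x) \<bullet> ?\<zeta> x) (at s within {-1..1})" for s
          unfolding f_def
          by (rule has_field_derivative_at_within[OF DERIV_Phi_eps_line[OF \<epsilon>]])
             (use p_bounds(1)[OF x] in auto)
        show "norm (A_eps \<epsilon> p x (?\<xi> x + s *\<^sub>R ?\<zeta> x) \<bullet> ?\<zeta> x) \<le> W 1 x powr (p x - 1) * norm (?\<zeta> x)"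
          if "s \<in> {-1..1}" for s
        proof -
          let ?r = "r_eps \<epsilon> (?\<xi> x + s *\<^sub>R ?\<zeta> x)"
          have "norm (A_eps \<epsilon> p x (?\<xi> x + s *\<^sub>R ?\<zeta> x) \<bullet> ?\<zeta> x)
              \<le> norm (A_eps \<epsilon> p x (?\<xi> x + s *\<^sub>R ?\<zeta> x)) * norm (?\<zeta> x)"
            by (simp add: Cauchy_Schwarz_ineq2)
          also have "\<dots> \<le> ?r powr (p x - 1) * norm (?\<zeta> x)"
            by (intro mult_right_mono norm_A_eps_le \<epsilon>) auto
          also have "\<dots> \<le> W 1 x powr (p x - 1) * norm (?\<zeta> x)"
            using rW[of s 1 x] r_eps_pos[OF \<epsilon>, of "?\<xi> x + s *\<^sub>R ?\<zeta> x"] p_bounds(1)[OF x] that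
            by (intro mult_right_mono powr_mono2) auto
          finally show ?thesis .
        qed
      qed (use t in auto)
      then show "\<bar>f t x - f 0 x\<bar> \<le> \<bar>t\<bar> * (W 1 x powr (p x - 1) * norm (?\<zeta> x))"
        by (simp add: mult.commute)
    qed
  qed
  ultimately show ?thesis by simp
qed

text \<open>The Lipschitz bound on \<open>G_delta\<close> and the boundedness of \<open>h\<close> give the dominating function
  \<open>C / \<delta> * \<bar>\<phi>\<bar>\<close>, which is integrable since the domain has finite measure.\<close>

lemma singular_term_has_derivative:
  assumes \<delta>: "0 < \<delta>" "\<delta> \<le> 1" and \<gamma>: "\<gamma> \<in> borel_measurable M" "\<forall>x\<in>\<Omega>. 0 < \<gamma> x \<and> \<gamma> x < 1"
    and h: "h \<in> Linfty \<Omega>"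
    and u: "u \<in> Lp \<Omega> p" "AE x in M. 0 \<le> u x" and \<phi>: "\<phi> \<in> Lp \<Omega> p"
  shows "integrable M (\<lambda>x. h x * (u x + \<delta>) powr (- \<gamma> x) * \<phi> x)"
    and "((\<lambda>t. \<integral>x. h x * G_delta \<delta> \<gamma> x (u x + t * \<phi> x) \<partial>M) has_real_derivative
      (\<integral>x. h x * (u x + \<delta>) powr (- \<gamma> x) * \<phi> x \<partial>M)) (at 0)"
proof -
  note [measurable] = Lp_measurable[OF u(1)] Lp_measurable[OF \<phi>] \<gamma>(1)
  obtain C where h_m [measurable]: "h \<in> borel_measurable M" and C: "AE x in M. \<bar>h x\<bar> \<le> C"
    using h by (auto simp: Linfty_def)
  define f where "f t x = h x * G_delta \<delta> \<gamma> x (u x + t * \<phi> x)" for t x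
  let ?f' = "\<lambda>x. h x * (u x + \<delta>) powr (- \<gamma> x) * \<phi> x"
  let ?w = "\<lambda>x. C / \<delta> * \<bar>\<phi> x\<bar>"
  have f_m [measurable]: "f t \<in> borel_measurable M" for t
    unfolding f_def by (intro borel_measurable_times G_delta_measurable) measurable
  have f_int: "integrable M (f t)" for t
  proof (rule Bochner_Integration.integrable_bound)
    have "(\<lambda>x. u x + t * \<phi> x) \<in> Lp \<Omega> p"
      using Lp_diff_cmult[OF u(1) \<phi>, of "- t"] by simp
    then show "integrable M (\<lambda>x. C / \<delta> * (u x + t * \<phi> x))"
      by (intro integrable_mult_right Lp_integrable)
    show "AE x in M. norm (f t x) \<le> norm (C / \<delta> * (u x + t * \<phi> x))"
      using C AE_space
    proof eventually_elim
      case (elim x)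
      have "\<bar>G_delta \<delta> \<gamma> x (u x + t * \<phi> x)\<bar> \<le> \<bar>u x + t * \<phi> x\<bar> / \<delta>"
        using G_delta_lipschitz[OF \<delta>, of \<gamma> x "u x + t * \<phi> x" 0] bspec[OF \<gamma>(2), of x] elim
        by (simp add: G_delta_def[of _ _ _ 0])
      then have "\<bar>f t x\<bar> \<le> C * (\<bar>u x + t * \<phi> x\<bar> / \<delta>)"
        unfolding f_def abs_mult using elim by (intro mult_mono) auto
      moreover have "0 \<le> C" using elim by linarith
      ultimately show ?case using \<delta> by (simp add: abs_mult)
    qed
  qed (rule f_m)
  have f'_m: "?f' \<in> borel_measurable M" by measurable
  have w: "integrable M ?w"
    using Lp_integrable[OF \<phi>] by (intro integrable_mult_right integrable_abs)
  have der: "AE x in M. ((\<lambda>t. f t x) has_real_derivative ?f' x) (at 0)"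
    using u(2) AE_space
  proof eventually_elim
    case (elim x)
    have "((\<lambda>t. u x + t * \<phi> x) has_real_derivative \<phi> x) (at 0)"
      by (auto intro!: derivative_eq_intros)
    moreover have "(G_delta \<delta> \<gamma> x has_real_derivative (u x + \<delta>) powr (- \<gamma> x)) (at (u x + 0 * \<phi> x))"
      using DERIV_G_delta[of \<delta> \<gamma> x "u x"] \<delta> bspec[OF \<gamma>(2), of x] elim by simp
    ultimately have "((\<lambda>t. G_delta \<delta> \<gamma> x (u x + t * \<phi> x)) has_real_derivative
        (u x + \<delta>) powr (- \<gamma> x) * \<phi> x) (at 0)"
      by (rule DERIV_chain2[rotated])
    from DERIV_cmult[OF this, of "h x"] show ?case
      by (simp add: f_def mult.assoc)
  qed
  have bound: "AE x in M. \<bar>f t x - f 0 x\<bar> \<le> \<bar>t\<bar> * ?w x" for t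
    using C AE_space
  proof eventually_elim
    case (elim x)
    have "\<bar>f t x - f 0 x\<bar> = \<bar>h x\<bar> * \<bar>G_delta \<delta> \<gamma> x (u x + t * \<phi> x) - G_delta \<delta> \<gamma> x (u x)\<bar>"
      by (simp add: f_def abs_mult[symmetric] right_diff_distrib)
    also have "\<dots> \<le> C * (\<bar>t * \<phi> x\<bar> / \<delta>)"
      using elim G_delta_lipschitz[OF \<delta>, of \<gamma> x "u x + t * \<phi> x" "u x"] bspec[OF \<gamma>(2), of x]
      by (intro mult_mono) auto
    finally show ?case by (simp add: abs_mult mult_ac)
  qed
  show "integrable M ?f'"
    by (rule integrable_derivative_dominated[OF f_int f'_m w der bound])
  show "((\<lambda>t. \<integral>x. h x * G_delta \<delta> \<gamma> x (u x + t * \<phi> x) \<partial>M) has_real_derivative (\<integral>x. ?f' x \<partial>M)) (at 0)"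
    using has_derivative_integral_dominated[OF f_int f'_m w der bound] by (simp add: f_def)
qed

end

section \<open>The Lagrange multiplier\<close>

text \<open>The algebra of Lagrange multipliers: a linear functional \<open>L\<close> that vanishes on the kernel of a linear
  functional \<open>B\<close> is a multiple of \<open>B\<close>, and the factor is determined by any \<open>e\<close> outside the kernel. The
  space enters only through the projections \<open>comb v c\<close>, which stands for \<open>v - c e\<close>.\<close>

lemma ex1_multiplier:
  fixes L B :: "'v \<Rightarrow> real"
  assumes e: "e \<in> S" "B e \<noteq> 0"
    and L: "\<And>v c. v \<in> S \<Longrightarrow> L (comb v c) = L v - c * L e"
    and B: "\<And>v c. v \<in> S \<Longrightarrow> B (comb v c) = B v - c * B e"
    and S: "\<And>v c. v \<in> S \<Longrightarrow> comb v c \<in> S"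
    and ker: "\<And>v. v \<in> S \<Longrightarrow> B v = 0 \<Longrightarrow> L v = 0"
  shows "\<exists>!\<Lambda>. \<forall>v\<in>S. L v = \<Lambda> * B v"
proof (rule ex1I)
  show "\<forall>v\<in>S. L v = L e / B e * B v"
  proof
    fix v assume v: "v \<in> S"
    have "L (comb v (B v / B e)) = 0"
      using v e B by (intro ker S) auto
    then show "L v = L e / B e * B v" using L[OF v, of "B v / B e"] by simp
  qed
  show "\<Lambda> = L e / B e" if "\<forall>v\<in>S. L v = \<Lambda> * B v" for \<Lambda>
    using that e by simp
qed

text \<open>Continuity is what makes the exponent measurable. The modulus \<open>C / ln (exp 1 + 1 / r)\<close>
  drops below \<open>e\<close> as soon as \<open>r < exp (- (C / e))\<close>.\<close>

lemma log_holder_on_imp_continuous_on: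
  assumes "log_holder_on S p"
  shows "continuous_on S p"
proof -
  obtain C where C: "0 < C"
    and p: "\<And>x y. x \<in> S \<Longrightarrow> y \<in> S \<Longrightarrow> x \<noteq> y \<Longrightarrow> \<bar>p x - p y\<bar> \<le> C / ln (exp 1 + 1 / norm (x - y))"
    using assms by (auto simp: log_holder_on_def)
  show ?thesis
    unfolding continuous_on_iff
  proof (intro ballI allI impI)
    fix x and e :: real assume x: "x \<in> S" and e: "0 < e"
    have "dist (p y) (p x) < e" if y: "y \<in> S" and d: "dist y x < exp (- (C / e))" for y
    proof (cases "y = x")
      case False
      then have n: "0 < norm (y - x)" "norm (y - x) < exp (- (C / e))" using d by (auto simp: dist_norm)
      have "exp (C / e) < 1 / norm (y - x)"
        using n by (simp add: exp_minus field_simps)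
      also have "\<dots> < exp 1 + 1 / norm (y - x)" by simp
      finally have "C / e < ln (exp 1 + 1 / norm (y - x))"
        by (metis exp_gt_zero exp_ln exp_less_cancel_iff order_less_trans)
      moreover from this have "0 < ln (exp 1 + 1 / norm (y - x))"
        using C e by (meson divide_pos_pos order_less_trans)
      ultimately have "C / ln (exp 1 + 1 / norm (y - x)) < e"
        using e by (simp add: field_simps)
      then show ?thesis using p[OF y x False] by (simp add: dist_real_def)
    qed (use e in simp)
    then show "\<exists>d>0. \<forall>x'\<in>S. dist x' x < d \<longrightarrow> dist (p x') (p x) < e"
      by (intro exI[of _ "exp (- (C / e))"]) auto
  qed
qed

theorem lemma2p10:
  fixes \<Omega> :: "(real ^ 'n) set"
    and p h \<gamma> u :: "real ^ 'n \<Rightarrow> real"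
    and \<epsilon> m \<mu> \<delta> \<gamma>_min \<gamma>_max :: real
  assumes "CARD('n) \<ge> 2"
    and "bounded_lipschitz_domain \<Omega>"
    and "\<epsilon> > 0" and "m > 0" and "\<mu> \<ge> 0" and "0 < \<delta>" and "\<delta> \<le> 1"
    and "variable_exponent \<Omega> p"
    and "h \<in> Linfty \<Omega>"
    and "AE x in lebesgue_on \<Omega>. h x \<ge> 0"
    and "\<not> (AE x in lebesgue_on \<Omega>. h x = 0)"
    and "continuous_on (closure \<Omega>) \<gamma>"
    and "0 < \<gamma>_min" and "\<gamma>_max < 1"
    and "\<forall>x\<in>closure \<Omega>. \<gamma>_min \<le> \<gamma> x \<and> \<gamma> x \<le> \<gamma>_max"
    and "minimizes_on (I_fun \<Omega> p \<epsilon> h \<gamma> \<mu> \<delta>) (M_plus \<Omega> p m) u"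
    and "signed_variations_admissible \<Omega> p \<epsilon> h \<gamma> \<mu> \<delta> u"
  shows "\<exists>!\<Lambda>::real. \<forall>\<phi>\<in>W01p \<Omega> p.
    (\<integral>x. A_eps \<epsilon> p x (weak_grad \<Omega> u x) \<bullet> weak_grad \<Omega> \<phi> x \<partial>lebesgue_on \<Omega>)
      = \<Lambda> * (\<integral>x. u x powr (p x - 1) * \<phi> x \<partial>lebesgue_on \<Omega>)
        + \<mu> * (\<integral>x. h x * (u x + \<delta>) powr (- \<gamma> x) * \<phi> x \<partial>lebesgue_on \<Omega>)"
proof -
  have \<Omega>: "open \<Omega>" "bounded \<Omega>"
    using assms(2) by (auto simp: bounded_lipschitz_domain_def)
  have \<Omega>_sets: "\<Omega> \<in> sets lebesgue" using \<Omega>(1) by simp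
  obtain p_min P where p_min: "1 < p_min" and pb: "\<And>x. x \<in> closure \<Omega> \<Longrightarrow> p_min \<le> p x \<and> p x \<le> P"
    and log: "log_holder_on (closure \<Omega>) p"
    using assms(8) by (auto simp: variable_exponent_def)
  have p_m: "p \<in> borel_measurable (lebesgue_on \<Omega>)"
    by (rule continuous_imp_measurable_on_sets_lebesgue[OF continuous_on_subset[OF
            log_holder_on_imp_continuous_on[OF log] closure_subset] \<Omega>_sets])
  have \<gamma>_m: "\<gamma> \<in> borel_measurable (lebesgue_on \<Omega>)"
    by (rule continuous_imp_measurable_on_sets_lebesgue[OF continuous_on_subset[OF
            assms(12) closure_subset] \<Omega>_sets])
  have \<gamma>b: "\<forall>x\<in>\<Omega>. 0 < \<gamma> x \<and> \<gamma> x < 1"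
    using assms(13-15) closure_subset[of \<Omega>] by force
  interpret variable_exponent_domain \<Omega> p P
    using \<Omega> p_m p_min pb closure_subset[of \<Omega>] by unfold_locales force+

  have u0: "u \<in> W01p \<Omega> p" and u_nonneg: "AE x in M. 0 \<le> u x" and Ju: "J_fun \<Omega> p u = m"
    using assms(16) by (auto simp: minimizes_on_def M_plus_def W01p_nonneg_def)
  note u1 = W01p_W1p[OF u0] and uL = W1pD(1)[OF W01p_W1p[OF u0]]

  define D where "D \<phi> = (\<integral>x. A_eps \<epsilon> p x (weak_grad \<Omega> u x) \<bullet> weak_grad \<Omega> \<phi> x \<partial>M)" for \<phi>
  define H where "H \<phi> = (\<integral>x. h x * (u x + \<delta>) powr (- \<gamma> x) * \<phi> x \<partial>M)" for \<phi>
  define B where "B \<phi> = (\<integral>x. u x powr (p x - 1) * \<phi> x \<partial>M)" for \<phi>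

  have D_lin: "D (\<lambda>x. \<phi> x - c * u x) = D \<phi> - c * D u" if \<phi>: "\<phi> \<in> W01p \<Omega> p" for \<phi> c
  proof -
    note \<phi>1 = W01p_W1p[OF \<phi>]
    let ?A = "\<lambda>x. A_eps \<epsilon> p x (weak_grad \<Omega> u x)"
    have "D (\<lambda>x. \<phi> x - c * u x) = (\<integral>x. ?A x \<bullet> weak_grad \<Omega> \<phi> x - c * (?A x \<bullet> weak_grad \<Omega> u x) \<partial>M)"
      unfolding D_def
    proof (rule integral_cong_AE)
      show "AE x in M. ?A x \<bullet> weak_grad \<Omega> (\<lambda>x. \<phi> x - c * u x) x
          = ?A x \<bullet> weak_grad \<Omega> \<phi> x - c * (?A x \<bullet> weak_grad \<Omega> u x)"
        using weak_grad_diff_cmult[OF \<phi>1 u1, of c] by eventually_elim (simp add: inner_diff_right)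
    qed (intro borel_measurable_integrable Bochner_Integration.integrable_diff integrable_mult_right
          gradient_term_integrable[OF assms(3) u1] W1p_diff_cmult \<phi>1 u1)+
    also have "\<dots> = D \<phi> - c * D u"
      using gradient_term_integrable[OF assms(3) u1 \<phi>1] gradient_term_integrable[OF assms(3) u1 u1]
      by (simp add: D_def)
    finally show ?thesis .
  qed
  note singular = singular_term_has_derivative[OF assms(6,7) \<gamma>_m \<gamma>b assms(9) uL u_nonneg]
  have H_lin: "H (\<lambda>x. \<phi> x - c * u x) = H \<phi> - c * H u" if \<phi>: "\<phi> \<in> W01p \<Omega> p" for \<phi> c
    using singular(1)[OF W1pD(1)[OF W01p_W1p[OF \<phi>]]] singular(1)[OF uL]
    by (simp add: H_def right_diff_distrib mult.left_commute[of _ c])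
  have B_lin: "B (\<lambda>x. \<phi> x - c * u x) = B \<phi> - c * B u" if \<phi>: "\<phi> \<in> W01p \<Omega> p" for \<phi> c
    using power_term_integrable[OF uL u_nonneg W1pD(1)[OF W01p_W1p[OF \<phi>]]]
      power_term_integrable[OF uL u_nonneg uL]
    by (simp add: B_def right_diff_distrib mult.left_commute[of _ c])

  have kernel: "D \<phi> - \<mu> * H \<phi> = 0" if \<phi>: "\<phi> \<in> W01p \<Omega> p" "B \<phi> = 0" for \<phi>
  proof -
    have "\<phi> \<in> tangent_space \<Omega> p u"
      using \<phi> by (simp add: tangent_space_def B_def)
    then have "((\<lambda>t. I_fun \<Omega> p \<epsilon> h \<gamma> \<mu> \<delta> (\<lambda>x. u x + t * \<phi> x)) has_real_derivative 0) (at 0)"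
      using assms(17) by (simp add: signed_variations_admissible_def)
    moreover have "((\<lambda>t. I_fun \<Omega> p \<epsilon> h \<gamma> \<mu> \<delta> (\<lambda>x. u x + t * \<phi> x)) has_real_derivative
        D \<phi> - \<mu> * H \<phi>) (at 0)"
      unfolding I_fun_def D_def H_def
      by (intro DERIV_diff DERIV_cmult singular(2) E_eps_has_derivative assms(3) u1
          W1pD(1) W01p_W1p \<phi>(1))
    ultimately show ?thesis by (rule DERIV_unique[symmetric])
  qed

  \<comment> \<open>The constraint \<open>J_fun u = m > 0\<close> is regular at \<open>u\<close>: its derivative in the direction \<open>u\<close> is nonzero.\<close>
  have "B u \<noteq> 0"
  proof
    assume "B u = 0"
    then have "AE x in M. u x powr (p x - 1) * u x = 0"
    proof (subst integral_nonneg_eq_0_iff_AE[symmetric])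
      show "AE x in M. 0 \<le> u x powr (p x - 1) * u x"
        using u_nonneg by eventually_elim simp
    qed (simp_all add: B_def power_term_integrable[OF uL u_nonneg uL])
    then have "AE x in M. \<bar>u x\<bar> powr p x / p x = 0"
      by eventually_elim auto
    then have "J_fun \<Omega> p u = 0"
      unfolding J_fun_def by (rule integral_eq_zero_AE)
    then show False using Ju assms(4) by simp
  qed
  then have "\<exists>!\<Lambda>. \<forall>\<phi>\<in>W01p \<Omega> p. D \<phi> - \<mu> * H \<phi> = \<Lambda> * B \<phi>"
  proof (rule ex1_multiplier[where comb = "\<lambda>\<phi> c x. \<phi> x - c * u x", rotated])
    show "D (\<lambda>x. \<phi> x - c * u x) - \<mu> * H (\<lambda>x. \<phi> x - c * u x) = D \<phi> - \<mu> * H \<phi> - c * (D u - \<mu> * H u)"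
      if "\<phi> \<in> W01p \<Omega> p" for \<phi> c
      unfolding D_lin[OF that] H_lin[OF that] by (simp add: algebra_simps)
  qed (use u0 B_lin kernel W01p_diff_cmult in auto)
  then show ?thesis
    by (simp add: D_def H_def B_def diff_eq_eq)
qed

end
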